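(* Let $(M,g)$ be an $n$-dimensional $(N(k),\xi)$-semi-Riemannian manifold and let $a_0,\dots,a_7$ be real numbers with $a_0+na_1+a_2+a_3+a_5+a_6\neq 0$. Suppose $M$ is $(R,S_{\mathcal{T}_a})$-pseudosymmetric, i.e. $R\cdot S_{\mathcal{T}_a}=L\,Q(g,S_{\mathcal{T}_a})$ holds on the set $\mathcal{U}=\{x\in M:(S_{\mathcal{T}_a}-\frac{\mathrm{tr}(S_{\mathcal{T}_a})}{n}g)_x\neq 0\}$ for some function $L$ on $\mathcal{U}$. Then either $M$ is an Einstein manifold with $S=k(n-1)g$, or $L=k$ holds (wherever $L$ is defined, i.e. on $\mathcal{U}$). Consequently, under the condition $R\cdot S_{\mathcal{T}_a}=L\,Q(g,S_{\mathcal{T}_a})$: if $M$ is an $N(k)$-contact metric manifold, then $S=k(n-1)g$ or $L=k$; if $M$ is Sasakian, then $S=(n-1)g$ or $L=1$; if $M$ is Kenmotsu, then $S=-(n-1)g$ or $L=-1$; if $M$ is $(\varepsilon)$-Sasakian, then $S=\varepsilon(n-1)g$ or $L=\varepsilon$; if $M$ is para-Sasakian, then $S=-(n-1)g$ or $L=-1$; if $M$ is $(\varepsilon)$-para-Sasakian, then $S=-\varepsilon(n-1)g$ or $L=-\varepsilon$.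
   Context: $(M,g)$ is an $n$-dimensional semi-Riemannian manifold; $\nabla$ its Levi-Civita connection, $R$ its curvature tensor (sign convention: constant curvature $c$ means $R(X,Y)Z=c(g(Y,Z)X-g(X,Z)Y)$), $S(Y,Z)=\mathrm{tr}(X\mapsto R(X,Y)Z)$ the Ricci tensor, $Q$ the Ricci operator ($g(QX,Y)=S(X,Y)$), $r$ the scalar curvature. $(N(k),\xi)$-semi-Riemannian manifold: $k$ is a real number and $\xi$ is a vector field with $g(\xi,\xi)=\varepsilon\in\{1,-1\}$ lying in the $k$-nullity distribution, i.e. $R(X,Y)\xi=k(g(Y,\xi)X-g(X,\xi)Y)$ for all $X,Y$; $\eta(X)=\varepsilon g(X,\xi)$. For real $a_0,\dots,a_7$, $\mathcal{T}_a(X,Y)Z=a_0R(X,Y)Z+a_1S(Y,Z)X+a_2S(X,Z)Y+a_3S(X,Y)Z+a_4g(Y,Z)QX+a_5g(X,Z)QY+a_6g(X,Y)QZ+a_7r(g(Y,Z)X-g(X,Z)Y)$, and $S_{\mathcal{T}_a}(Y,Z)=\mathrm{tr}(X\mapsto\mathcal{T}_a(X,Y)Z)$, i.e. $S_{\mathcal{T}_a}=(a_0+na_1+a_2+a_3+a_5+a_6)S+(a_4+(n-1)a_7)r\,g$; $\mathrm{tr}$ of a $(0,2)$ tensor is the $g$-trace. For a $(0,2)$ tensor $K$ and endomorphism $F$, $(F\cdot K)(U,V)=-K(FU,V)-K(U,FV)$. $(R\cdot K)(U,V;X,Y)=(R(X,Y)\cdot K)(U,V)$, and $Q(g,K)(U,V;X,Y)=((X\wedge_g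 Y)\cdot K)(U,V)$ with $(X\wedge_g Y)Z=g(Y,Z)X-g(X,Z)Y$. Classes of manifolds (each is an $(N(k),\xi)$-semi-Riemannian manifold with the indicated $k$). $(\varepsilon)$-almost contact metric structure $(\varphi,\xi,\eta,g,\varepsilon)$: $\varphi^2=-I+\eta\otimes\xi$, $\eta(\xi)=1$, $g(\varphi X,\varphi Y)=g(X,Y)-\varepsilon\eta(X)\eta(Y)$, $\varepsilon=\pm1$; "almost contact metric" means $\varepsilon=1$ and $g$ Riemannian. $N(k)$-contact metric: almost contact metric with $d\eta(X,Y)=g(X,\varphi Y)$ and $\xi$ in the $k$-nullity distribution. $(\varepsilon)$-Sasakian ($k=\varepsilon$): $(\varepsilon)$-almost contact metric with $(\nabla_X\varphi)Y=g(X,Y)\xi-\varepsilon\eta(Y)X$; Sasakian ($k=1$): the case $\varepsilon=1$, $g$ Riemannian. Kenmotsu ($k=-1$): almost contact metric with $(\nabla_X\varphi)Y=g(\varphi X,Y)\xi-\eta(Y)\varphi X$. $(\varepsilon)$-para-Sasakian ($k=-\varepsilon$): $\varphi^2=I-\eta\otimes\xi$, $\eta(\xi)=1$, $g(\varphi X,\varphi Y)=g(X,Y)-\varepsilon\eta(X)\eta(Y)$, $(\nabla_X\varphi)Y=-g(\varphi X,\varphi Y)\xi-\varepsilon\eta(Y)\varphi^2X$; para-Sasakian ($k=-1$): the case $\varepsilon=1$, $g$ Riemannian. *)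

theory Defs
  imports "HOL-Analysis.Analysis"
begin

section \<open>Smooth maps between Euclidean spaces\<close>

text \<open>Meant for open \<open>S\<close> and a finite-dimensional domain, where it is the usual notion of
  a \<open>C\<^sup>k\<close> map (all iterated directional derivatives exist and are continuous).\<close>

primrec Ck_on ::
  "nat \<Rightarrow> 'b::real_normed_vector set \<Rightarrow> ('b \<Rightarrow> 'c::real_normed_vector) \<Rightarrow> bool" where
  "Ck_on 0 S f \<longleftrightarrow> continuous_on S f"
| "Ck_on (Suc k) S f \<longleftrightarrow> (\<forall>x\<in>S. f differentiable (at x)) \<and>
     (\<forall>v. Ck_on k S (\<lambda>x. frechet_derivative f (at x) v))"

definition smooth_on ::
  "'b::real_normed_vector set \<Rightarrow> ('b \<Rightarrow> 'c::real_normed_vector) \<Rightarrow> bool" where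
  "smooth_on S f \<longleftrightarrow> (\<forall>k. Ck_on k S f)"


section \<open>Smooth manifolds and smooth functions\<close>

text \<open>A chart is a pair \<open>(U, \<phi>)\<close>; the dimension of the manifold is \<open>CARD('n)\<close>. The atlas need
  not be maximal.\<close>

record ('p, 'n) mfd =
  topol :: "'p topology"
  atlas :: "('p set \<times> ('p \<Rightarrow> real ^ 'n)) set"

abbreviation points :: "('p, 'n::finite) mfd \<Rightarrow> 'p set" where
  "points M \<equiv> topspace (topol M)"

definition smooth_manifold :: "('p, 'n::finite) mfd \<Rightarrow> bool" where
  "smooth_manifold M \<longleftrightarrow>
     Hausdorff_space (topol M) \<and> second_countable (topol M) \<and>
     (\<forall>(U, \<phi>)\<in>atlas M. openin (topol M) U \<and> open (\<phi> ` U) \<and>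
        homeomorphic_map (subtopology (topol M) U) (top_of_set (\<phi> ` U)) \<phi>) \<and>
     (\<Union>(U, \<phi>)\<in>atlas M. U) = points M \<and>
     (\<forall>(U, \<phi>)\<in>atlas M. \<forall>(V, \<psi>)\<in>atlas M. smooth_on (\<phi> ` (U \<inter> V)) (\<psi> \<circ> inv_into U \<phi>))"

definition smooth_fun :: "('p, 'n::finite) mfd \<Rightarrow> 'p set \<Rightarrow> ('p \<Rightarrow> real) \<Rightarrow> bool" where
  "smooth_fun M W f \<longleftrightarrow>
     (\<forall>(U, \<phi>)\<in>atlas M. smooth_on (\<phi> ` (U \<inter> W)) (f \<circ> inv_into U \<phi>))"

definition smooth_near :: "('p, 'n::finite) mfd \<Rightarrow> 'p \<Rightarrow> ('p \<Rightarrow> real) \<Rightarrow> bool" where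
  "smooth_near M x f \<longleftrightarrow> (\<exists>W. openin (topol M) W \<and> x \<in> W \<and> smooth_fun M W f)"


section \<open>Tangent vectors and vector fields\<close>

text \<open>Tangent vectors act on functions as directional derivatives. The type below is merely
  a copy of the type of all functionals on functions, carrying the pointwise vector space
  structure; the tangent spaces are subspaces of it.\<close>

typedef 'p tangent = "UNIV :: (('p \<Rightarrow> real) \<Rightarrow> real) set"
  morphisms act Tangent
  by simp

lemma act_Tangent [simp]: "act (Tangent d) = d"
  by (simp add: Tangent_inverse)

lemma tangent_eqI: "(\<And>f. act v f = act w f) \<Longrightarrow> v = w"
  by (metis act_inject ext)

instantiation tangent :: (type) real_vector
begin

definition "0 = Tangent (\<lambda>f. 0)"
definition "v + w = Tangent (\<lambda>f. act v f + act w f)"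
definition "v - w = Tangent (\<lambda>f. act v f - act w f)"
definition "- v = Tangent (\<lambda>f. - act v f)"
definition "c *\<^sub>R v = Tangent (\<lambda>f. c * act v f)"

instance
  by standard
    (auto intro!: tangent_eqI simp: zero_tangent_def plus_tangent_def minus_tangent_def
      uminus_tangent_def scaleR_tangent_def algebra_simps)

end

text \<open>The directional derivative at \<open>x\<close> with component vector \<open>u\<close> in the chart \<open>(U, \<phi>)\<close>. It is
  set to zero on functions that are not smooth near \<open>x\<close>, so that it is determined by its values
  on germs of smooth functions.\<close>

definition coord_vector ::
  "('p, 'n::finite) mfd \<Rightarrow> 'p \<Rightarrow> 'p set \<Rightarrow> ('p \<Rightarrow> real ^ 'n) \<Rightarrow> real ^ 'n \<Rightarrow> 'p tangent" where
  "coord_vector M x U \<phi> u =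
     Tangent (\<lambda>f. if smooth_near M x f
                  then frechet_derivative (f \<circ> inv_into U \<phi>) (at (\<phi> x)) u else 0)"

definition tangent_space :: "('p, 'n::finite) mfd \<Rightarrow> 'p \<Rightarrow> 'p tangent set" where
  "tangent_space M x = {coord_vector M x U \<phi> u | U \<phi> u. (U, \<phi>) \<in> atlas M \<and> x \<in> U}"

text \<open>Vector fields are total functions on points, of which only the values on the open set
  \<open>W\<close> matter.\<close>

definition vector_field_on ::
  "('p, 'n::finite) mfd \<Rightarrow> 'p set \<Rightarrow> ('p \<Rightarrow> 'p tangent) \<Rightarrow> bool" where
  "vector_field_on M W X \<longleftrightarrow>
     (\<forall>x\<in>W. X x \<in> tangent_space M x) \<and>
     (\<forall>W' f. openin (topol M) W' \<and> W' \<subseteq> W \<and> smooth_fun M W' f \<longrightarrow>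
        smooth_fun M W' (\<lambda>x. act (X x) f))"

definition lie_bracket ::
  "('p, 'n::finite) mfd \<Rightarrow> ('p \<Rightarrow> 'p tangent) \<Rightarrow> ('p \<Rightarrow> 'p tangent) \<Rightarrow> 'p \<Rightarrow> 'p tangent" where
  "lie_bracket M X Y x =
     Tangent (\<lambda>f. if smooth_near M x f
                  then act (X x) (\<lambda>y. act (Y y) f) - act (Y x) (\<lambda>y. act (X y) f) else 0)"


section \<open>Tensor fields and multilinear algebra on a tangent space\<close>

definition linear_within ::
  "'v::real_vector set \<Rightarrow> ('v \<Rightarrow> 'w::real_vector) \<Rightarrow> bool" where
  "linear_within V F \<longleftrightarrow>
     (\<forall>u\<in>V. \<forall>v\<in>V. F (u + v) = F u + F v) \<and> (\<forall>c. \<forall>u\<in>V. F (c *\<^sub>R u) = c *\<^sub>R F u)"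

definition one_form ::
  "('p, 'n::finite) mfd \<Rightarrow> ('p \<Rightarrow> 'p tangent \<Rightarrow> real) \<Rightarrow> bool" where
  "one_form M \<omega> \<longleftrightarrow>
     (\<forall>x\<in>points M. linear_within (tangent_space M x) (\<omega> x)) \<and>
     (\<forall>W X. openin (topol M) W \<and> vector_field_on M W X \<longrightarrow> smooth_fun M W (\<lambda>x. \<omega> x (X x)))"

definition endo_field ::
  "('p, 'n::finite) mfd \<Rightarrow> ('p \<Rightarrow> 'p tangent \<Rightarrow> 'p tangent) \<Rightarrow> bool" where
  "endo_field M F \<longleftrightarrow>
     (\<forall>x\<in>points M. linear_within (tangent_space M x) (F x) \<and>
        (\<forall>u\<in>tangent_space M x. F x u \<in> tangent_space M x)) \<and>
     (\<forall>W X. openin (topol M) W \<and> vector_field_on M W X \<longrightarrow>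
        vector_field_on M W (\<lambda>x. F x (X x)))"

definition bilinear_field ::
  "('p, 'n::finite) mfd \<Rightarrow> ('p \<Rightarrow> 'p tangent \<Rightarrow> 'p tangent \<Rightarrow> real) \<Rightarrow> bool" where
  "bilinear_field M K \<longleftrightarrow>
     (\<forall>x\<in>points M. \<forall>u\<in>tangent_space M x.
        linear_within (tangent_space M x) (\<lambda>v. K x u v) \<and>
        linear_within (tangent_space M x) (\<lambda>v. K x v u)) \<and>
     (\<forall>W X Y. openin (topol M) W \<and> vector_field_on M W X \<and> vector_field_on M W Y \<longrightarrow>
        smooth_fun M W (\<lambda>x. K x (X x) (Y x)))"

text \<open>Trace of an endomorphism of a finite-dimensional subspace \<open>V\<close>, computed in some basis.\<close>

definition trace_on :: "'v::real_vector set \<Rightarrow> ('v \<Rightarrow> 'v) \<Rightarrow> real" where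
  "trace_on V F =
     (let B = (SOME B. independent B \<and> span B = V) in \<Sum>b\<in>B. representation B (F b) b)"

text \<open>The operator associated with a bilinear form \<open>K\<close> by \<open>h (sharp V h K u) v = K u v\<close>.\<close>

definition sharp ::
  "'v set \<Rightarrow> ('v \<Rightarrow> 'v \<Rightarrow> real) \<Rightarrow> ('v \<Rightarrow> 'v \<Rightarrow> real) \<Rightarrow> 'v \<Rightarrow> 'v" where
  "sharp V h K u = (THE w. w \<in> V \<and> (\<forall>v\<in>V. h w v = K u v))"

definition metric_trace ::
  "'v::real_vector set \<Rightarrow> ('v \<Rightarrow> 'v \<Rightarrow> real) \<Rightarrow> ('v \<Rightarrow> 'v \<Rightarrow> real) \<Rightarrow> real" where
  "metric_trace V h K = trace_on V (sharp V h K)"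

definition derivation_act ::
  "('v \<Rightarrow> 'v) \<Rightarrow> ('v \<Rightarrow> 'v \<Rightarrow> real) \<Rightarrow> 'v \<Rightarrow> 'v \<Rightarrow> real" where
  "derivation_act F K u v = - K (F u) v - K u (F v)"

definition wedge ::
  "('v::real_vector \<Rightarrow> 'v \<Rightarrow> real) \<Rightarrow> 'v \<Rightarrow> 'v \<Rightarrow> 'v \<Rightarrow> 'v" where
  "wedge h u v w = h v w *\<^sub>R u - h u w *\<^sub>R v"


section \<open>Semi-Riemannian metrics and the Levi-Civita connection\<close>

definition metric_index ::
  "('p, 'n::finite) mfd \<Rightarrow> ('p \<Rightarrow> 'p tangent \<Rightarrow> 'p tangent \<Rightarrow> real) \<Rightarrow> 'p \<Rightarrow> nat" where
  "metric_index M g x =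
     Max {dim V | V. subspace V \<and> V \<subseteq> tangent_space M x \<and> (\<forall>v\<in>V. v \<noteq> 0 \<longrightarrow> g x v v < 0)}"

definition semi_riemannian_metric ::
  "('p, 'n::finite) mfd \<Rightarrow> ('p \<Rightarrow> 'p tangent \<Rightarrow> 'p tangent \<Rightarrow> real) \<Rightarrow> bool" where
  "semi_riemannian_metric M g \<longleftrightarrow>
     bilinear_field M g \<and>
     (\<forall>x\<in>points M. \<forall>u\<in>tangent_space M x. \<forall>v\<in>tangent_space M x. g x u v = g x v u) \<and>
     (\<forall>x\<in>points M. \<forall>u\<in>tangent_space M x. (\<forall>v\<in>tangent_space M x. g x u v = 0) \<longrightarrow> u = 0) \<and>
     (\<exists>\<nu>. \<forall>x\<in>points M. metric_index M g x = \<nu>)"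

definition riemannian_metric ::
  "('p, 'n::finite) mfd \<Rightarrow> ('p \<Rightarrow> 'p tangent \<Rightarrow> 'p tangent \<Rightarrow> real) \<Rightarrow> bool" where
  "riemannian_metric M g \<longleftrightarrow> semi_riemannian_metric M g \<and>
     (\<forall>x\<in>points M. \<forall>u\<in>tangent_space M x. u \<noteq> 0 \<longrightarrow> g x u u > 0)"

text \<open>A connection differentiates vector fields defined on arbitrary open sets \<open>W\<close>. (A connection
  on global fields extends uniquely to local ones. That \<open>(\<nabla>\<^sub>X Y) x\<close> depends on \<open>X\<close> and \<open>Y\<close> only
  near \<open>x\<close> follows from the rules for multiplication by functions.)\<close>

type_synonym 'p connection =
  "('p \<Rightarrow> 'p tangent) \<Rightarrow> ('p \<Rightarrow> 'p tangent) \<Rightarrow> 'p \<Rightarrow> 'p tangent"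

definition affine_connection :: "('p, 'n::finite) mfd \<Rightarrow> 'p connection \<Rightarrow> bool" where
  "affine_connection M D \<longleftrightarrow>
     (\<forall>W. openin (topol M) W \<longrightarrow>
       (\<forall>X Y. vector_field_on M W X \<and> vector_field_on M W Y \<longrightarrow> vector_field_on M W (D X Y)) \<and>
       (\<forall>X X' Y. vector_field_on M W X \<and> vector_field_on M W X' \<and> vector_field_on M W Y \<longrightarrow>
          (\<forall>x\<in>W. D (\<lambda>y. X y + X' y) Y x = D X Y x + D X' Y x \<and>
                 D Y (\<lambda>y. X y + X' y) x = D Y X x + D Y X' x)) \<and>
       (\<forall>f X Y. smooth_fun M W f \<and> vector_field_on M W X \<and> vector_field_on M W Y \<longrightarrow>
          (\<forall>x\<in>W. D (\<lambda>y. f y *\<^sub>R X y) Y x = f x *\<^sub>R D X Y x \<and>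
                 D X (\<lambda>y. f y *\<^sub>R Y y) x = f x *\<^sub>R D X Y x + act (X x) f *\<^sub>R Y x)))"

definition levi_civita ::
  "('p, 'n::finite) mfd \<Rightarrow> ('p \<Rightarrow> 'p tangent \<Rightarrow> 'p tangent \<Rightarrow> real) \<Rightarrow> 'p connection \<Rightarrow> bool" where
  "levi_civita M g D \<longleftrightarrow> affine_connection M D \<and>
     (\<forall>W. openin (topol M) W \<longrightarrow>
       (\<forall>X Y. vector_field_on M W X \<and> vector_field_on M W Y \<longrightarrow>
          (\<forall>x\<in>W. D X Y x - D Y X x = lie_bracket M X Y x)) \<and>
       (\<forall>X Y Z. vector_field_on M W X \<and> vector_field_on M W Y \<and> vector_field_on M W Z \<longrightarrow>
          (\<forall>x\<in>W. act (X x) (\<lambda>y. g y (Y y) (Z y)) = g x (D X Y x) (Z x) + g x (Y x) (D X Z x))))"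


section \<open>Curvature\<close>

definition curvature_fields ::
  "('p, 'n::finite) mfd \<Rightarrow> 'p connection \<Rightarrow>
   ('p \<Rightarrow> 'p tangent) \<Rightarrow> ('p \<Rightarrow> 'p tangent) \<Rightarrow> ('p \<Rightarrow> 'p tangent) \<Rightarrow> 'p \<Rightarrow> 'p tangent" where
  "curvature_fields M D X Y Z x = D X (D Y Z) x - D Y (D X Z) x - D (lie_bracket M X Y) Z x"

text \<open>The value of the curvature tensor on tangent vectors at \<open>x\<close> is obtained by extending them to
  vector fields near \<open>x\<close>; by tensoriality the choice of the extensions is irrelevant.\<close>

definition extend_vector ::
  "('p, 'n::finite) mfd \<Rightarrow> 'p \<Rightarrow> 'p tangent \<Rightarrow> 'p \<Rightarrow> 'p tangent" where
  "extend_vector M x u =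
     (SOME X. X x = u \<and> (\<exists>W. openin (topol M) W \<and> x \<in> W \<and> vector_field_on M W X))"

definition curvature ::
  "('p, 'n::finite) mfd \<Rightarrow> 'p connection \<Rightarrow> 'p \<Rightarrow>
   'p tangent \<Rightarrow> 'p tangent \<Rightarrow> 'p tangent \<Rightarrow> 'p tangent" where
  "curvature M D x u v w =
     curvature_fields M D (extend_vector M x u) (extend_vector M x v) (extend_vector M x w) x"

definition ricci ::
  "('p, 'n::finite) mfd \<Rightarrow> 'p connection \<Rightarrow> 'p \<Rightarrow> 'p tangent \<Rightarrow> 'p tangent \<Rightarrow> real" where
  "ricci M D x v w = trace_on (tangent_space M x) (\<lambda>u. curvature M D x u v w)"

definition ricci_op ::
  "('p, 'n::finite) mfd \<Rightarrow> ('p \<Rightarrow> 'p tangent \<Rightarrow> 'p tangent \<Rightarrow> real) \<Rightarrow> 'p connection \<Rightarrow>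
   'p \<Rightarrow> 'p tangent \<Rightarrow> 'p tangent" where
  "ricci_op M g D x = sharp (tangent_space M x) (g x) (ricci M D x)"

definition scalar_curvature ::
  "('p, 'n::finite) mfd \<Rightarrow> ('p \<Rightarrow> 'p tangent \<Rightarrow> 'p tangent \<Rightarrow> real) \<Rightarrow> 'p connection \<Rightarrow>
   'p \<Rightarrow> real" where
  "scalar_curvature M g D x = metric_trace (tangent_space M x) (g x) (ricci M D x)"

text \<open>The tensor \<open>T\<^sub>a\<close>; of the sequence \<open>a\<close> only the entries \<open>a 0, \<dots>, a 7\<close> are used.\<close>

definition T_curvature ::
  "('p, 'n::finite) mfd \<Rightarrow> ('p \<Rightarrow> 'p tangent \<Rightarrow> 'p tangent \<Rightarrow> real) \<Rightarrow> 'p connection \<Rightarrow>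
   (nat \<Rightarrow> real) \<Rightarrow> 'p \<Rightarrow> 'p tangent \<Rightarrow> 'p tangent \<Rightarrow> 'p tangent \<Rightarrow> 'p tangent" where
  "T_curvature M g D a x u v w =
     a 0 *\<^sub>R curvature M D x u v w
     + (a 1 * ricci M D x v w) *\<^sub>R u
     + (a 2 * ricci M D x u w) *\<^sub>R v
     + (a 3 * ricci M D x u v) *\<^sub>R w
     + (a 4 * g x v w) *\<^sub>R ricci_op M g D x u
     + (a 5 * g x u w) *\<^sub>R ricci_op M g D x v
     + (a 6 * g x u v) *\<^sub>R ricci_op M g D x w
     + (a 7 * scalar_curvature M g D x) *\<^sub>R (g x v w *\<^sub>R u - g x u w *\<^sub>R v)"

definition T_ricci ::
  "('p, 'n::finite) mfd \<Rightarrow> ('p \<Rightarrow> 'p tangent \<Rightarrow> 'p tangent \<Rightarrow> real) \<Rightarrow> 'p connection \<Rightarrow>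
   (nat \<Rightarrow> real) \<Rightarrow> 'p \<Rightarrow> 'p tangent \<Rightarrow> 'p tangent \<Rightarrow> real" where
  "T_ricci M g D a x v w = trace_on (tangent_space M x) (\<lambda>u. T_curvature M g D a x u v w)"

text \<open>\<open>S = c g\<close>\<close>

definition einstein_with ::
  "('p, 'n::finite) mfd \<Rightarrow> ('p \<Rightarrow> 'p tangent \<Rightarrow> 'p tangent \<Rightarrow> real) \<Rightarrow> 'p connection \<Rightarrow>
   real \<Rightarrow> bool" where
  "einstein_with M g D c \<longleftrightarrow>
     (\<forall>x\<in>points M. \<forall>u\<in>tangent_space M x. \<forall>v\<in>tangent_space M x. ricci M D x u v = c * g x u v)"


section \<open>Pseudosymmetry\<close>

text \<open>The set \<open>\<U>\<close> of points where \<open>S\<^sub>T - (tr S\<^sub>T / n) g\<close> does not vanish.\<close>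

definition pseudo_set ::
  "('p, 'n::finite) mfd \<Rightarrow> ('p \<Rightarrow> 'p tangent \<Rightarrow> 'p tangent \<Rightarrow> real) \<Rightarrow> 'p connection \<Rightarrow>
   (nat \<Rightarrow> real) \<Rightarrow> 'p set" where
  "pseudo_set M g D a =
     {x \<in> points M. \<exists>u\<in>tangent_space M x. \<exists>v\<in>tangent_space M x.
        T_ricci M g D a x u v
        - metric_trace (tangent_space M x) (g x) (T_ricci M g D a x) / real CARD('n) * g x u v
        \<noteq> 0}"

definition ricci_pseudosymmetric ::
  "('p, 'n::finite) mfd \<Rightarrow> ('p \<Rightarrow> 'p tangent \<Rightarrow> 'p tangent \<Rightarrow> real) \<Rightarrow> 'p connection \<Rightarrow>
   (nat \<Rightarrow> real) \<Rightarrow> ('p \<Rightarrow> real) \<Rightarrow> bool" where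
  "ricci_pseudosymmetric M g D a L \<longleftrightarrow>
     (\<forall>x\<in>pseudo_set M g D a.
        \<forall>X\<in>tangent_space M x. \<forall>Y\<in>tangent_space M x.
        \<forall>u\<in>tangent_space M x. \<forall>v\<in>tangent_space M x.
          derivation_act (curvature M D x X Y) (T_ricci M g D a x) u v
          = L x * derivation_act (wedge (g x) X Y) (T_ricci M g D a x) u v)"


section \<open>The classes of manifolds\<close>

definition N_manifold ::
  "('p, 'n::finite) mfd \<Rightarrow> ('p \<Rightarrow> 'p tangent \<Rightarrow> 'p tangent \<Rightarrow> real) \<Rightarrow> 'p connection \<Rightarrow>
   real \<Rightarrow> ('p \<Rightarrow> 'p tangent) \<Rightarrow> real \<Rightarrow> bool" where
  "N_manifold M g D k \<xi> \<epsilon> \<longleftrightarrow>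
     smooth_manifold M \<and> semi_riemannian_metric M g \<and> levi_civita M g D \<and>
     \<epsilon> \<in> {1, -1} \<and> vector_field_on M (points M) \<xi> \<and>
     (\<forall>x\<in>points M. g x (\<xi> x) (\<xi> x) = \<epsilon>) \<and>
     (\<forall>x\<in>points M. \<forall>u\<in>tangent_space M x. \<forall>v\<in>tangent_space M x.
        curvature M D x u v (\<xi> x) = k *\<^sub>R (g x v (\<xi> x) *\<^sub>R u - g x u (\<xi> x) *\<^sub>R v))"

text \<open>The parameter \<open>s\<close> distinguishes almost contact (\<open>s = -1\<close>, \<open>\<phi>\<^sup>2 = -I + \<eta> \<otimes> \<xi>\<close>) from
  almost paracontact structures (\<open>s = 1\<close>, \<open>\<phi>\<^sup>2 = I - \<eta> \<otimes> \<xi>\<close>).\<close>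

definition structure_tensors ::
  "real \<Rightarrow> ('p, 'n::finite) mfd \<Rightarrow> ('p \<Rightarrow> 'p tangent \<Rightarrow> 'p tangent \<Rightarrow> real) \<Rightarrow>
   ('p \<Rightarrow> 'p tangent \<Rightarrow> 'p tangent) \<Rightarrow> ('p \<Rightarrow> 'p tangent) \<Rightarrow> ('p \<Rightarrow> 'p tangent \<Rightarrow> real) \<Rightarrow>
   real \<Rightarrow> bool" where
  "structure_tensors s M g \<phi> \<xi> \<eta> \<epsilon> \<longleftrightarrow>
     smooth_manifold M \<and> semi_riemannian_metric M g \<and> \<epsilon> \<in> {1, -1} \<and>
     endo_field M \<phi> \<and> vector_field_on M (points M) \<xi> \<and> one_form M \<eta> \<and>
     (\<forall>x\<in>points M. \<eta> x (\<xi> x) = 1) \<and>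
     (\<forall>x\<in>points M. \<forall>u\<in>tangent_space M x. \<phi> x (\<phi> x u) = s *\<^sub>R (u - \<eta> x u *\<^sub>R \<xi> x)) \<and>
     (\<forall>x\<in>points M. \<forall>u\<in>tangent_space M x. \<forall>v\<in>tangent_space M x.
        g x (\<phi> x u) (\<phi> x v) = g x u v - \<epsilon> * \<eta> x u * \<eta> x v)"

abbreviation "eps_almost_contact_metric \<equiv> structure_tensors (-1)"

abbreviation "eps_almost_paracontact_metric \<equiv> structure_tensors 1"

definition almost_contact_metric ::
  "('p, 'n::finite) mfd \<Rightarrow> ('p \<Rightarrow> 'p tangent \<Rightarrow> 'p tangent \<Rightarrow> real) \<Rightarrow>
   ('p \<Rightarrow> 'p tangent \<Rightarrow> 'p tangent) \<Rightarrow> ('p \<Rightarrow> 'p tangent) \<Rightarrow> ('p \<Rightarrow> 'p tangent \<Rightarrow> real) \<Rightarrow>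
   bool" where
  "almost_contact_metric M g \<phi> \<xi> \<eta> \<longleftrightarrow>
     eps_almost_contact_metric M g \<phi> \<xi> \<eta> 1 \<and> riemannian_metric M g"

text \<open>The factor \<open>1/2\<close> is the convention of contact metric geometry (Blair), under which
  Sasakian manifolds are contact metric manifolds.\<close>

definition ext_deriv ::
  "('p, 'n::finite) mfd \<Rightarrow> ('p \<Rightarrow> 'p tangent \<Rightarrow> real) \<Rightarrow>
   ('p \<Rightarrow> 'p tangent) \<Rightarrow> ('p \<Rightarrow> 'p tangent) \<Rightarrow> 'p \<Rightarrow> real" where
  "ext_deriv M \<omega> X Y x =
     (act (X x) (\<lambda>y. \<omega> y (Y y)) - act (Y x) (\<lambda>y. \<omega> y (X y)) - \<omega> x (lie_bracket M X Y x)) / 2"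

text \<open>\<open>(\<nabla>\<^sub>X \<phi>) Y\<close>\<close>

definition endo_deriv ::
  "'p connection \<Rightarrow> ('p \<Rightarrow> 'p tangent \<Rightarrow> 'p tangent) \<Rightarrow>
   ('p \<Rightarrow> 'p tangent) \<Rightarrow> ('p \<Rightarrow> 'p tangent) \<Rightarrow> 'p \<Rightarrow> 'p tangent" where
  "endo_deriv D \<phi> X Y x = D X (\<lambda>y. \<phi> y (Y y)) x - \<phi> x (D X Y x)"

definition N_contact_metric ::
  "('p, 'n::finite) mfd \<Rightarrow> ('p \<Rightarrow> 'p tangent \<Rightarrow> 'p tangent \<Rightarrow> real) \<Rightarrow> 'p connection \<Rightarrow>
   real \<Rightarrow> ('p \<Rightarrow> 'p tangent \<Rightarrow> 'p tangent) \<Rightarrow> ('p \<Rightarrow> 'p tangent) \<Rightarrow>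
   ('p \<Rightarrow> 'p tangent \<Rightarrow> real) \<Rightarrow> bool" where
  "N_contact_metric M g D k \<phi> \<xi> \<eta> \<longleftrightarrow>
     almost_contact_metric M g \<phi> \<xi> \<eta> \<and>
     (\<forall>W X Y. openin (topol M) W \<and> vector_field_on M W X \<and> vector_field_on M W Y \<longrightarrow>
        (\<forall>x\<in>W. ext_deriv M \<eta> X Y x = g x (X x) (\<phi> x (Y x)))) \<and>
     N_manifold M g D k \<xi> 1"

definition eps_sasakian ::
  "('p, 'n::finite) mfd \<Rightarrow> ('p \<Rightarrow> 'p tangent \<Rightarrow> 'p tangent \<Rightarrow> real) \<Rightarrow> 'p connection \<Rightarrow>
   ('p \<Rightarrow> 'p tangent \<Rightarrow> 'p tangent) \<Rightarrow> ('p \<Rightarrow> 'p tangent) \<Rightarrow> ('p \<Rightarrow> 'p tangent \<Rightarrow> real) \<Rightarrow>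
   real \<Rightarrow> bool" where
  "eps_sasakian M g D \<phi> \<xi> \<eta> \<epsilon> \<longleftrightarrow>
     eps_almost_contact_metric M g \<phi> \<xi> \<eta> \<epsilon> \<and> levi_civita M g D \<and>
     (\<forall>W X Y. openin (topol M) W \<and> vector_field_on M W X \<and> vector_field_on M W Y \<longrightarrow>
        (\<forall>x\<in>W. endo_deriv D \<phi> X Y x = g x (X x) (Y x) *\<^sub>R \<xi> x - (\<epsilon> * \<eta> x (Y x)) *\<^sub>R X x))"

definition sasakian ::
  "('p, 'n::finite) mfd \<Rightarrow> ('p \<Rightarrow> 'p tangent \<Rightarrow> 'p tangent \<Rightarrow> real) \<Rightarrow> 'p connection \<Rightarrow>
   ('p \<Rightarrow> 'p tangent \<Rightarrow> 'p tangent) \<Rightarrow> ('p \<Rightarrow> 'p tangent) \<Rightarrow> ('p \<Rightarrow> 'p tangent \<Rightarrow> real) \<Rightarrow>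
   bool" where
  "sasakian M g D \<phi> \<xi> \<eta> \<longleftrightarrow> eps_sasakian M g D \<phi> \<xi> \<eta> 1 \<and> riemannian_metric M g"

definition kenmotsu ::
  "('p, 'n::finite) mfd \<Rightarrow> ('p \<Rightarrow> 'p tangent \<Rightarrow> 'p tangent \<Rightarrow> real) \<Rightarrow> 'p connection \<Rightarrow>
   ('p \<Rightarrow> 'p tangent \<Rightarrow> 'p tangent) \<Rightarrow> ('p \<Rightarrow> 'p tangent) \<Rightarrow> ('p \<Rightarrow> 'p tangent \<Rightarrow> real) \<Rightarrow>
   bool" where
  "kenmotsu M g D \<phi> \<xi> \<eta> \<longleftrightarrow>
     almost_contact_metric M g \<phi> \<xi> \<eta> \<and> levi_civita M g D \<and>
     (\<forall>W X Y. openin (topol M) W \<and> vector_field_on M W X \<and> vector_field_on M W Y \<longrightarrow>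
        (\<forall>x\<in>W. endo_deriv D \<phi> X Y x =
           g x (\<phi> x (X x)) (Y x) *\<^sub>R \<xi> x - \<eta> x (Y x) *\<^sub>R \<phi> x (X x)))"

definition eps_para_sasakian ::
  "('p, 'n::finite) mfd \<Rightarrow> ('p \<Rightarrow> 'p tangent \<Rightarrow> 'p tangent \<Rightarrow> real) \<Rightarrow> 'p connection \<Rightarrow>
   ('p \<Rightarrow> 'p tangent \<Rightarrow> 'p tangent) \<Rightarrow> ('p \<Rightarrow> 'p tangent) \<Rightarrow> ('p \<Rightarrow> 'p tangent \<Rightarrow> real) \<Rightarrow>
   real \<Rightarrow> bool" where
  "eps_para_sasakian M g D \<phi> \<xi> \<eta> \<epsilon> \<longleftrightarrow>
     eps_almost_paracontact_metric M g \<phi> \<xi> \<eta> \<epsilon> \<and> levi_civita M g D \<and>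
     (\<forall>W X Y. openin (topol M) W \<and> vector_field_on M W X \<and> vector_field_on M W Y \<longrightarrow>
        (\<forall>x\<in>W. endo_deriv D \<phi> X Y x =
           - (g x (\<phi> x (X x)) (\<phi> x (Y x)) *\<^sub>R \<xi> x)
           - (\<epsilon> * \<eta> x (Y x)) *\<^sub>R \<phi> x (\<phi> x (X x))))"

definition para_sasakian ::
  "('p, 'n::finite) mfd \<Rightarrow> ('p \<Rightarrow> 'p tangent \<Rightarrow> 'p tangent \<Rightarrow> real) \<Rightarrow> 'p connection \<Rightarrow>
   ('p \<Rightarrow> 'p tangent \<Rightarrow> 'p tangent) \<Rightarrow> ('p \<Rightarrow> 'p tangent) \<Rightarrow> ('p \<Rightarrow> 'p tangent \<Rightarrow> real) \<Rightarrow>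
   bool" where
  "para_sasakian M g D \<phi> \<xi> \<eta> \<longleftrightarrow> eps_para_sasakian M g D \<phi> \<xi> \<eta> 1 \<and> riemannian_metric M g"

end

theory Submission
  imports Defs
begin

text \<open>The algebraic heart is a statement about one tangent space. Put \<open>S\<^sub>T\<close> for the trace of \<open>T\<^sub>a\<close>. It has
  the form \<open>\<alpha> S + \<beta> g\<close> (\<open>trace_T\<close>), so it is symmetric. The pair symmetry of the curvature turns the
  nullity condition on \<open>R(X, Y) \<xi>\<close> into \<open>R(\<xi>, Y) = k (\<xi> \<and> Y)\<close> (\<open>nullity_curvature\<close>). If \<open>L \<noteq> k\<close> at a point
  of \<open>\<U>\<close>, then pseudosymmetry with \<open>X = \<xi>\<close> says that all \<open>\<xi> \<and> Y\<close> annihilate \<open>S\<^sub>T\<close>, and a symmetric form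
  with this property is a multiple \<open>c g\<close> of the metric (\<open>pseudosymmetric_form\<close>). Its trace is \<open>n c\<close>, so
  \<open>S\<^sub>T - (tr S\<^sub>T / n) g\<close> vanishes, and the point does not lie in \<open>\<U>\<close>. Hence \<open>L = k\<close> on the whole of \<open>\<U>\<close>
  (\<open>pseudosymmetric_function\<close>), so that the second alternative holds in every case.

  This uses that the curvature is a tensor with the usual symmetries. The curvature at a point is
  formed from arbitrarily chosen extensions of tangent vectors, so tensoriality (\<open>R_pointwise\<close>) is what
  gives access to it: any convenient fields may be used instead (\<open>curvature_eq\<close>). Skewness comes from
  compatibility with the metric, and the Bianchi identity is the Jacobi identity, by vanishing torsion.

  For the special classes, the identity for the derivative of \<open>\<phi>\<close>, applied to \<open>\<xi>\<close>, determines the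
  derivative of \<open>\<xi>\<close>: it is \<open>-\<epsilon> \<phi> X\<close> in the Sasakian case, \<open>\<epsilon> \<phi> X\<close> in the para-Sasakian case
  and \<open>X - \<eta>(X) \<xi>\<close> in the Kenmotsu case. Differentiating once more gives \<open>R(X, Y) \<xi>\<close> and hence the nullity
  condition with \<open>k = \<epsilon>\<close>, \<open>k = -\<epsilon>\<close> and \<open>k = -1\<close>.\<close>

section \<open>Calculus of smooth maps\<close>

lemma frechet_derivative_cong_open:
  assumes "open S" "x \<in> S" "\<And>y. y \<in> S \<Longrightarrow> f y = g y"
  shows "frechet_derivative f (at x) = frechet_derivative g (at x)"
proof -
  have "(f has_derivative f') (at x) \<longleftrightarrow> (g has_derivative f') (at x)" for f'
    using has_derivative_transform_within_open[OF _ assms(1,2), of f f' UNIV g]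
      has_derivative_transform_within_open[OF _ assms(1,2), of g f' UNIV f] assms(3) by auto
  then show ?thesis
    by (simp add: frechet_derivative_def)
qed

lemma differentiable_cong_open:
  assumes "open S" "x \<in> S" "\<And>y. y \<in> S \<Longrightarrow> f y = g y" "f differentiable (at x)"
  shows "g differentiable (at x)"
  using assms(4) has_derivative_transform_within_open[OF _ assms(1,2), of f _ UNIV g] assms(3)
  unfolding differentiable_def by auto

lemma Ck_on_cong:
  assumes "open S" "\<And>x. x \<in> S \<Longrightarrow> f x = g x" "Ck_on k S f"
  shows "Ck_on k S g"
  using assms(2,3)
proof (induction k arbitrary: f g)
  case 0
  then show ?case using continuous_on_cong[of S S f g] by simp
next
  case (Suc k)
  have eq: "frechet_derivative f (at x) = frechet_derivative g (at x)" if "x \<in> S" for x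
    using frechet_derivative_cong_open[OF assms(1) that] Suc.prems(1) by blast
  have "Ck_on k S (\<lambda>x. frechet_derivative g (at x) v)" for v
    by (rule Suc.IH[of "\<lambda>x. frechet_derivative f (at x) v"]) (use Suc.prems(2) eq in auto)
  moreover have "g differentiable (at x)" if "x \<in> S" for x
    by (rule differentiable_cong_open[OF assms(1) that, of f]) (use Suc.prems that in auto)
  ultimately show ?case by simp
qed

lemma Ck_on_subset: "Ck_on k S f \<Longrightarrow> T \<subseteq> S \<Longrightarrow> Ck_on k T f"
  by (induction k arbitrary: f) (auto intro: continuous_on_subset)

lemma Ck_on_Suc_imp: "Ck_on (Suc k) S f \<Longrightarrow> Ck_on k S f"
proof (induction k arbitrary: f)
  case 0
  then show ?case
    by (auto intro!: continuous_at_imp_continuous_on differentiable_imp_continuous_within)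
next
  case (Suc k)
  then show ?case by (metis Ck_on.simps(2))
qed

lemma Ck_on_const: "Ck_on k S (\<lambda>x. c)"
  by (induction k arbitrary: c) auto

lemma Ck_on_add:
  assumes "open S"
  shows "Ck_on k S f \<Longrightarrow> Ck_on k S g \<Longrightarrow> Ck_on k S (\<lambda>x. f x + g x)"
proof (induction k arbitrary: f g)
  case 0
  then show ?case by (simp add: continuous_on_add)
next
  case (Suc k)
  have d: "((\<lambda>x. f x + g x) has_derivative
      (\<lambda>v. frechet_derivative f (at x) v + frechet_derivative g (at x) v)) (at x)"
    if "x \<in> S" for x
    using Suc.prems that
    by (intro has_derivative_add) (auto simp: frechet_derivative_works[THEN iffD1])
  have "Ck_on k S (\<lambda>x. frechet_derivative (\<lambda>x. f x + g x) (at x) v)" for v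
  proof (rule Ck_on_cong[OF assms])
    show "Ck_on k S (\<lambda>x. frechet_derivative f (at x) v + frechet_derivative g (at x) v)"
      using Suc.prems by (intro Suc.IH) auto
  qed (rule fun_cong[OF frechet_derivative_at[OF d]])
  then show ?case using d by (auto simp: differentiable_def)
qed

lemma Ck_on_sum:
  assumes "open S" "\<And>i. i \<in> I \<Longrightarrow> Ck_on k S (f i)"
  shows "Ck_on k S (\<lambda>x. \<Sum>i\<in>I. f i x)"
  using assms(2)
  by (induction I rule: infinite_finite_induct)
    (auto intro: Ck_on_const Ck_on_add[OF assms(1)])

lemma Ck_on_bounded_linear:
  assumes "open S" "bounded_linear l"
  shows "Ck_on k S f \<Longrightarrow> Ck_on k S (\<lambda>x. l (f x))"
proof (induction k arbitrary: f)
  case 0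
  then show ?case
    using bounded_linear.continuous_on[OF assms(2)] by simp
next
  case (Suc k)
  have d: "((\<lambda>x. l (f x)) has_derivative (\<lambda>v. l (frechet_derivative f (at x) v))) (at x)"
    if "x \<in> S" for x
    using Suc.prems that
    by (intro bounded_linear.has_derivative[OF assms(2)]) (auto simp: frechet_derivative_works[THEN iffD1])
  have "Ck_on k S (\<lambda>x. frechet_derivative (\<lambda>x. l (f x)) (at x) v)" for v
  proof (rule Ck_on_cong[OF assms(1)])
    show "Ck_on k S (\<lambda>x. l (frechet_derivative f (at x) v))"
      using Suc.prems by (intro Suc.IH) auto
  qed (rule fun_cong[OF frechet_derivative_at[OF d]])
  then show ?case using d by (auto simp: differentiable_def)
qed

lemma Ck_on_scaleR:
  assumes "open S"
  shows "Ck_on k S f \<Longrightarrow> Ck_on k S g \<Longrightarrow> Ck_on k S (\<lambda>x. f x *\<^sub>R g x)"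
proof (induction k arbitrary: f g)
  case 0
  then show ?case by (simp add: continuous_on_scaleR)
next
  case (Suc k)
  have d: "((\<lambda>x. f x *\<^sub>R g x) has_derivative
      (\<lambda>v. f x *\<^sub>R frechet_derivative g (at x) v + frechet_derivative f (at x) v *\<^sub>R g x)) (at x)"
    if "x \<in> S" for x
    using Suc.prems that by (intro has_derivative_scaleR) (auto simp: frechet_derivative_works[THEN iffD1])
  have "Ck_on k S (\<lambda>x. frechet_derivative (\<lambda>x. f x *\<^sub>R g x) (at x) v)" for v
  proof (rule Ck_on_cong[OF assms])
    show "Ck_on k S (\<lambda>x. f x *\<^sub>R frechet_derivative g (at x) v
        + frechet_derivative f (at x) v *\<^sub>R g x)"
      using Suc.prems Ck_on_Suc_imp[of k S f] Ck_on_Suc_imp[of k S g]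
      by (intro Ck_on_add[OF assms] Suc.IH) auto
  qed (rule fun_cong[OF frechet_derivative_at[OF d]])
  then show ?case using d by (auto simp: differentiable_def)
qed

text \<open>In the chain rule the derivative of the outer map is expanded in the finite basis of its
  domain; this writes the derivative of a composition as a sum of products of maps that are
  one order less smooth, to which the induction hypothesis applies.\<close>

lemma Ck_on_compose:
  fixes f :: "'a::euclidean_space \<Rightarrow> 'c::real_normed_vector"
    and h :: "'b::real_normed_vector \<Rightarrow> 'a"
  assumes "open S" "h ` S \<subseteq> T"
  shows "Ck_on k T f \<Longrightarrow> Ck_on k S h \<Longrightarrow> Ck_on k S (\<lambda>x. f (h x))"
proof (induction k arbitrary: f)
  case 0
  then show ?case using assms(2) continuous_on_compose2 by fastforce
next
  case (Suc k)
  have d: "((\<lambda>x. f (h x)) has_derivative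
      (\<lambda>v. frechet_derivative f (at (h x)) (frechet_derivative h (at x) v))) (at x)"
    if "x \<in> S" for x
    using Suc.prems that assms(2)
    by (intro has_derivative_compose[of h _ x UNIV f]) (auto simp: frechet_derivative_works[THEN iffD1])
  have "Ck_on k S (\<lambda>x. frechet_derivative (\<lambda>x. f (h x)) (at x) v)" for v
  proof (rule Ck_on_cong[OF assms(1)])
    show "Ck_on k S (\<lambda>x. \<Sum>b\<in>Basis. (frechet_derivative h (at x) v \<bullet> b) *\<^sub>R
        frechet_derivative f (at (h x)) b)"
    proof (intro Ck_on_sum Ck_on_scaleR assms(1))
      fix b :: 'a
      show "Ck_on k S (\<lambda>x. frechet_derivative h (at x) v \<bullet> b)"
        using Suc.prems by (intro Ck_on_bounded_linear[OF assms(1) bounded_linear_inner_left]) auto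
      show "Ck_on k S (\<lambda>x. frechet_derivative f (at (h x)) b)"
        using Suc.prems Ck_on_Suc_imp[of k S h]
        by (intro Suc.IH[of "\<lambda>y. frechet_derivative f (at y) b"]) auto
    qed
    show "(\<Sum>b\<in>Basis. (frechet_derivative h (at x) v \<bullet> b) *\<^sub>R frechet_derivative f (at (h x)) b)
        = frechet_derivative (\<lambda>x. f (h x)) (at x) v" if "x \<in> S" for x
    proof -
      have "linear (frechet_derivative f (at (h x)))"
        using Suc.prems(1) that assms(2) by (intro linear_frechet_derivative) auto
      then show ?thesis
        using linear_sum[of "frechet_derivative f (at (h x))" "\<lambda>b. (frechet_derivative h (at x) v \<bullet> b) *\<^sub>R b" Basis]
        by (simp add: linear_scale euclidean_representation
            flip: fun_cong[OF frechet_derivative_at[OF d[OF that]], of v])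
    qed
  qed
  then show ?case using d by (auto simp: differentiable_def)
qed

lemma smooth_on_cong:
  "open S \<Longrightarrow> (\<And>x. x \<in> S \<Longrightarrow> f x = g x) \<Longrightarrow> smooth_on S f \<Longrightarrow> smooth_on S g"
  unfolding smooth_on_def using Ck_on_cong by blast

lemma smooth_on_subset: "smooth_on S f \<Longrightarrow> T \<subseteq> S \<Longrightarrow> smooth_on T f"
  unfolding smooth_on_def using Ck_on_subset by blast

lemma smooth_on_const: "smooth_on S (\<lambda>x. c)"
  unfolding smooth_on_def using Ck_on_const by blast

lemma smooth_on_add:
  "open S \<Longrightarrow> smooth_on S f \<Longrightarrow> smooth_on S g \<Longrightarrow> smooth_on S (\<lambda>x. f x + g x)"
  unfolding smooth_on_def using Ck_on_add by blast

lemma smooth_on_mult: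
  fixes f g :: "_ \<Rightarrow> real"
  shows "open S \<Longrightarrow> smooth_on S f \<Longrightarrow> smooth_on S g \<Longrightarrow> smooth_on S (\<lambda>x. f x * g x)"
  unfolding smooth_on_def using Ck_on_scaleR[of S _ f g] by simp

lemma smooth_on_bounded_linear:
  "open S \<Longrightarrow> bounded_linear l \<Longrightarrow> smooth_on S f \<Longrightarrow> smooth_on S (\<lambda>x. l (f x))"
  unfolding smooth_on_def using Ck_on_bounded_linear by blast

lemma smooth_on_compose:
  fixes f :: "'a::euclidean_space \<Rightarrow> 'c::real_normed_vector"
  shows "open S \<Longrightarrow> h ` S \<subseteq> T \<Longrightarrow> smooth_on T f \<Longrightarrow> smooth_on S h \<Longrightarrow> smooth_on S (\<lambda>x. f (h x))"
  unfolding smooth_on_def using Ck_on_compose by blast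

lemma smooth_on_frechet_derivative:
  "smooth_on S f \<Longrightarrow> smooth_on S (\<lambda>x. frechet_derivative f (at x) v)"
  unfolding smooth_on_def using Ck_on.simps(2) by blast

lemma smooth_on_imp_differentiable: "smooth_on S f \<Longrightarrow> x \<in> S \<Longrightarrow> f differentiable (at x)"
  unfolding smooth_on_def by (meson Ck_on.simps(2))

lemma smooth_on_id: "smooth_on S (\<lambda>x. x)"
proof -
  have "Ck_on k S (\<lambda>x. x)" for k
    by (cases k) (auto intro: Ck_on_const)
  then show ?thesis by (simp add: smooth_on_def)
qed

section \<open>Traces and nondegenerate forms\<close>

lemma linear_within_sum:
  assumes "subspace V" "linear_within V F" "\<And>i. i \<in> I \<Longrightarrow> v i \<in> V"
  shows "F (\<Sum>i\<in>I. c i *\<^sub>R v i) = (\<Sum>i\<in>I. c i *\<^sub>R F (v i))"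
proof -
  have "F (0 *\<^sub>R 0) = 0 *\<^sub>R F 0"
    using assms(1,2) subspace_0 unfolding linear_within_def by blast
  then have zero: "F 0 = 0" by simp
  from assms(3) show ?thesis
  proof (induction I rule: infinite_finite_induct)
    case (insert i I)
    have "c i *\<^sub>R v i \<in> V" "(\<Sum>i\<in>I. c i *\<^sub>R v i) \<in> V"
      using insert.prems assms(1) by (auto intro: subspace_scale subspace_sum)
    then show ?case
      using insert assms(2) unfolding linear_within_def by simp
  qed (use zero in simp_all)
qed

text \<open>A linear isomorphism \<open>J\<close> from \<open>real ^ 'n\<close> onto \<open>V\<close> supplies the finite dimension of \<open>V\<close>; it
  will be the isomorphism given by a chart.\<close>

locale inner_space =
  fixes J :: "real ^ 'n \<Rightarrow> 'v::real_vector" and V :: "'v set" and h :: "'v \<Rightarrow> 'v \<Rightarrow> real"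
  assumes linear_J: "linear J" and inj_J: "inj J" and V_eq: "V = range J"
    and h_linear: "\<And>u. u \<in> V \<Longrightarrow> linear_within V (h u)"
    and h_sym: "\<And>u v. u \<in> V \<Longrightarrow> v \<in> V \<Longrightarrow> h u v = h v u"
    and h_nondeg: "\<And>u. u \<in> V \<Longrightarrow> (\<And>v. v \<in> V \<Longrightarrow> h u v = 0) \<Longrightarrow> u = 0"
begin

lemma V_subspace: "subspace V"
  unfolding V_eq using linear_J by (simp add: linear_subspace_image)

lemma h_add: "u \<in> V \<Longrightarrow> v \<in> V \<Longrightarrow> w \<in> V \<Longrightarrow> h u (v + w) = h u v + h u w"
  and h_scale: "u \<in> V \<Longrightarrow> v \<in> V \<Longrightarrow> h u (c *\<^sub>R v) = c * h u v"
  using h_linear by (auto simp: linear_within_def)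

lemma h_add_left: "u \<in> V \<Longrightarrow> v \<in> V \<Longrightarrow> w \<in> V \<Longrightarrow> h (v + w) u = h v u + h w u"
  using h_add h_sym V_subspace subspace_add by metis

lemma h_scale_left: "u \<in> V \<Longrightarrow> v \<in> V \<Longrightarrow> h (c *\<^sub>R v) u = c * h v u"
  using h_scale h_sym V_subspace subspace_scale by metis

lemma h_minus: "u \<in> V \<Longrightarrow> v \<in> V \<Longrightarrow> h u (- v) = - h u v"
  using h_scale[of u v "-1"] by simp

lemma h_minus_left: "u \<in> V \<Longrightarrow> v \<in> V \<Longrightarrow> h (- v) u = - h v u"
  using h_scale_left[of u v "-1"] by simp

lemma h_diff: "u \<in> V \<Longrightarrow> v \<in> V \<Longrightarrow> w \<in> V \<Longrightarrow> h u (v - w) = h u v - h u w"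
  using h_add[of u v "-w"] h_minus V_subspace subspace_neg by fastforce

lemma h_diff_left: "u \<in> V \<Longrightarrow> v \<in> V \<Longrightarrow> w \<in> V \<Longrightarrow> h (v - w) u = h v u - h w u"
  using h_diff h_sym V_subspace subspace_diff by metis

lemma h_zero: "u \<in> V \<Longrightarrow> h u 0 = 0"
  using h_scale[of u u 0] by simp

lemma h_eqI:
  assumes "u \<in> V" "w \<in> V" "\<And>v. v \<in> V \<Longrightarrow> h u v = h w v"
  shows "u = w"
  using h_nondeg[of "u - w"] assms V_subspace h_diff_left by (simp add: subspace_diff)

text \<open>In coordinates, pairing with the basis vectors is an injective linear endomorphism of \<open>real ^ 'n\<close>,
  and therefore surjective.\<close>

lemma h_represents:
  assumes "linear_within V \<omega>"
  shows "\<exists>!w. w \<in> V \<and> (\<forall>v\<in>V. h w v = \<omega> v)"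
proof -
  define f where "f y = (\<chi> i. h (J y) (J (axis i 1)))" for y :: "real ^ 'n"
  have JV: "J y \<in> V" for y by (simp add: V_eq)
  have expand: "J y = (\<Sum>i\<in>UNIV. y $ i *\<^sub>R J (axis i 1))" for y
  proof -
    have "J y = J (\<Sum>i\<in>UNIV. y $ i *\<^sub>R axis i 1)"
      by (metis basis_expansion scalar_mult_eq_scaleR)
    then show ?thesis
      using linear_J by (simp add: linear_sum linear_scale)
  qed
  have h_on: "h u (J y) = (\<Sum>i\<in>UNIV. y $ i * h u (J (axis i 1)))" if "u \<in> V" for u y
    using linear_within_sum[OF V_subspace h_linear[OF that], of UNIV "\<lambda>i. J (axis i 1)" "($) y"]
      expand[of y] JV by simp
  have "linear f"
    by (rule linearI) (auto simp: f_def vec_eq_iff linear_add[OF linear_J] linear_scale[OF linear_J]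
        h_add_left h_scale_left JV)
  moreover have "inj f"
  proof (subst linear_injective_0[OF \<open>linear f\<close>], intro allI impI)
    fix y assume "f y = 0"
    then have "h (J y) (J (axis i 1)) = 0" for i
      by (simp add: f_def vec_eq_iff)
    then have "h (J y) (J z) = 0" for z
      using h_on[OF JV, of y z] by simp
    then have "J y = 0" using h_nondeg[OF JV] V_eq by blast
    then have "J y = J 0" using linear_0[OF linear_J] by simp
    then show "y = 0" by (rule injD[OF inj_J])
  qed
  ultimately obtain y where y: "f y = (\<chi> i. \<omega> (J (axis i 1)))"
    using linear_injective_imp_surjective by (metis surj_def)
  have "h (J y) v = \<omega> v" if v: "v \<in> V" for v
  proof -
    obtain z where z: "v = J z" using v by (auto simp: V_eq)
    have "\<omega> (J z) = (\<Sum>i\<in>UNIV. z $ i * \<omega> (J (axis i 1)))"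
      using linear_within_sum[OF V_subspace assms, of UNIV "\<lambda>i. J (axis i 1)" "($) z"]
        expand[of z] JV by simp
    moreover have "h (J y) (J (axis i 1)) = \<omega> (J (axis i 1))" for i
      using y by (simp add: f_def vec_eq_iff)
    ultimately show ?thesis using h_on[OF JV, of y z] z by simp
  qed
  then show ?thesis using JV h_eqI by (intro ex1I[of _ "J y"]) auto
qed

lemma sharp_in: "linear_within V (K u) \<Longrightarrow> sharp V h K u \<in> V"
  and h_sharp: "linear_within V (K u) \<Longrightarrow> v \<in> V \<Longrightarrow> h (sharp V h K u) v = K u v"
  using theI'[OF h_represents[of "K u"]] by (auto simp: sharp_def)

lemma sharp_scaled: "u \<in> V \<Longrightarrow> (\<And>v. v \<in> V \<Longrightarrow> K u v = c * h u v) \<Longrightarrow> sharp V h K u = c *\<^sub>R u"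
  unfolding sharp_def
  by (rule the_equality) (auto intro!: h_eqI simp: V_subspace subspace_scale h_scale_left)

lemma finite_basis_of_V:
  assumes "independent B" "span B = V"
  shows "finite B" and "card B = CARD('n)"
proof -
  have inj': "inj_on J (span Basis)" using inj_J inj_on_subset by blast
  have "independent (J ` Basis)"
    using linear_independent_injective_image[OF linear_J independent_Basis inj'] .
  moreover have "span (J ` Basis) = V"
    using linear_J by (simp add: linear_span_image V_eq span_Basis)
  moreover have "card (J ` (Basis :: (real ^ 'n) set)) = CARD('n)"
    using card_image[of J Basis] inj_J inj_on_subset[of J UNIV Basis] by simp
  ultimately have C: "independent (J ` Basis)" "span (J ` Basis) = V" "finite (J ` Basis)"
    "card (J ` (Basis :: (real ^ 'n) set)) = CARD('n)"
    by auto
  then show fin: "finite B"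
    using independent_span_bound[of "J ` Basis" B] assms span_superset by blast
  show "card B = CARD('n)"
    using independent_span_bound[of "J ` Basis" B] independent_span_bound[of B "J ` Basis"]
      assms C fin span_superset by (metis order_antisym)
qed

text \<open>The basis in which \<open>trace_on\<close> computes the trace.\<close>

definition some_basis :: "'v set" where
  "some_basis = (SOME B. independent B \<and> span B = V)"

lemma some_basis: "independent some_basis" "span some_basis = V"
proof -
  have "\<exists>B. independent B \<and> span B = V"
    using basis_exists[of V] V_subspace by (metis span_subspace)
  from someI_ex[OF this] show "independent some_basis" "span some_basis = V"
    by (auto simp: some_basis_def)
qed

lemmas finite_some_basis = finite_basis_of_V(1)[OF some_basis]

lemma some_basis_in: "b \<in> some_basis \<Longrightarrow> b \<in> V"
  using some_basis span_base by blast

abbreviation coeff :: "'v \<Rightarrow> 'v \<Rightarrow> real" where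
  "coeff b v \<equiv> representation some_basis v b"

lemma trace_eq: "trace_on V F = (\<Sum>b\<in>some_basis. coeff b (F b))"
  by (simp add: trace_on_def some_basis_def Let_def)

lemma coeff_expand: "v \<in> V \<Longrightarrow> (\<Sum>b\<in>some_basis. coeff b v *\<^sub>R b) = v"
  using sum_representation_eq[of some_basis v some_basis] some_basis finite_some_basis by auto

lemma coeff_linear: "linear_within V (coeff b)"
  using some_basis by (simp add: linear_within_def representation_add representation_scale)

lemma linear_expand:
  assumes "linear_within V F" "v \<in> V"
  shows "F v = (\<Sum>b\<in>some_basis. coeff b v *\<^sub>R F b)"
  using linear_within_sum[OF V_subspace assms(1), of some_basis "\<lambda>b. b" "\<lambda>b. coeff b v"]
    coeff_expand[OF assms(2)] some_basis_in by simp

lemma trace_cong: "(\<And>u. u \<in> V \<Longrightarrow> F u = G u) \<Longrightarrow> trace_on V F = trace_on V G"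
  using some_basis_in by (simp add: trace_eq)

lemma trace_add:
  assumes "\<And>u. u \<in> V \<Longrightarrow> F u \<in> V" "\<And>u. u \<in> V \<Longrightarrow> G u \<in> V"
  shows "trace_on V (\<lambda>u. F u + G u) = trace_on V F + trace_on V G"
  using assms some_basis some_basis_in
  by (simp add: trace_eq representation_add sum.distrib)

lemma trace_scale:
  assumes "\<And>u. u \<in> V \<Longrightarrow> F u \<in> V"
  shows "trace_on V (\<lambda>u. c *\<^sub>R F u) = c * trace_on V F"
  using assms some_basis some_basis_in
  by (simp add: trace_eq representation_scale sum_distrib_left)

lemma trace_diff:
  assumes "\<And>u. u \<in> V \<Longrightarrow> F u \<in> V" "\<And>u. u \<in> V \<Longrightarrow> G u \<in> V"
  shows "trace_on V (\<lambda>u. F u - G u) = trace_on V F - trace_on V G"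
  using assms some_basis some_basis_in
  by (simp add: trace_eq representation_diff sum_subtractf)

lemma trace_scaled_id: "trace_on V (\<lambda>u. c *\<^sub>R u) = c * real CARD('n)"
proof -
  have "coeff b (c *\<^sub>R b) = c" if "b \<in> some_basis" for b
    using that some_basis some_basis_in by (simp add: representation_scale representation_basis)
  then show ?thesis
    using finite_basis_of_V[OF some_basis] by (simp add: trace_eq)
qed

lemma trace_rank_one:
  assumes "linear_within V \<omega>" "v \<in> V"
  shows "trace_on V (\<lambda>u. \<omega> u *\<^sub>R v) = \<omega> v"
  using linear_expand[OF assms] some_basis assms(2)
  by (simp add: trace_eq representation_scale mult.commute)

text \<open>Let \<open>b'\<close> be the dual basis, so that the trace of \<open>F\<close> is the sum of the \<open>h b' (F b)\<close>.
  The coefficients of \<open>b'\<close> in the given basis form the symmetric matrix \<open>h b' c'\<close>, and this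
  symmetry implies that the sum of the \<open>h b (F b')\<close> is the same. If \<open>F\<close> is skew, the two sums are
  also opposite.\<close>

lemma trace_skew:
  assumes F: "linear_within V F" "\<And>v. v \<in> V \<Longrightarrow> F v \<in> V"
    and skew: "\<And>u v. u \<in> V \<Longrightarrow> v \<in> V \<Longrightarrow> h (F u) v = - h u (F v)"
  shows "trace_on V F = 0"
proof -
  define dual where "dual b = (THE w. w \<in> V \<and> (\<forall>v\<in>V. h w v = coeff b v))" for b
  have dual_in: "dual b \<in> V" and h_dual: "\<And>v. v \<in> V \<Longrightarrow> h (dual b) v = coeff b v" for b
    using theI'[OF h_represents[OF coeff_linear[of b]]] by (auto simp: dual_def)
  have coeff_dual: "coeff c (dual b) = h (dual b) (dual c)" for b c
    using h_dual[OF dual_in] h_sym[OF dual_in dual_in] by simp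
  have "trace_on V F = (\<Sum>b\<in>some_basis. h (dual b) (F b))"
    using h_dual F(2) some_basis_in by (simp add: trace_eq)
  also have "\<dots> = (\<Sum>b\<in>some_basis. - h b (F (dual b)))"
    using skew dual_in some_basis_in F(2) h_sym by (intro sum.cong) auto
  also have "\<dots> = - (\<Sum>b\<in>some_basis. h b (F (dual b)))"
    by (rule sum_negf)
  also have "(\<Sum>b\<in>some_basis. h b (F (dual b)))
      = (\<Sum>b\<in>some_basis. \<Sum>c\<in>some_basis. h (dual b) (dual c) * h b (F c))"
  proof (rule sum.cong[OF refl])
    fix b assume b: "b \<in> some_basis"
    have "F (dual b) = (\<Sum>c\<in>some_basis. h (dual b) (dual c) *\<^sub>R F c)"
      using linear_expand[OF F(1) dual_in] coeff_dual by simp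
    then show "h b (F (dual b)) = (\<Sum>c\<in>some_basis. h (dual b) (dual c) * h b (F c))"
      using linear_within_sum[OF V_subspace h_linear[OF some_basis_in[OF b]], of some_basis F]
        F(2) some_basis_in by simp
  qed
  also have "\<dots> = (\<Sum>c\<in>some_basis. \<Sum>b\<in>some_basis. h (dual b) (dual c) * h b (F c))"
    by (rule sum.swap)
  also have "\<dots> = (\<Sum>c\<in>some_basis. h (dual c) (F c))"
  proof (rule sum.cong[OF refl])
    fix c assume c: "c \<in> some_basis"
    have Fc: "F c \<in> V" using F(2) some_basis_in c by blast
    have "h (F c) (dual c) = (\<Sum>b\<in>some_basis. coeff b (dual c) *\<^sub>R h (F c) b)"
      by (rule linear_expand[OF h_linear[OF Fc] dual_in])
    then show "(\<Sum>b\<in>some_basis. h (dual b) (dual c) * h b (F c)) = h (dual c) (F c)"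
      using coeff_dual h_sym dual_in Fc some_basis_in by simp
  qed
  also have "\<dots> = trace_on V F"
    using h_dual F(2) some_basis_in by (simp add: trace_eq)
  finally show ?thesis by simp
qed

end

section \<open>Tangent spaces and vector fields in charts\<close>

lemma act_simps [simp]:
  "act 0 f = 0" "act (v + w) f = act v f + act w f" "act (v - w) f = act v f - act w f"
  "act (- v) f = - act v f" "act (c *\<^sub>R v) f = c * act v f"
  by (simp_all add: zero_tangent_def plus_tangent_def minus_tangent_def uminus_tangent_def
      scaleR_tangent_def)

locale manifold =
  fixes M :: "('p, 'n::finite) mfd"
  assumes smooth_manifold: "smooth_manifold M"
begin

abbreviation open_in :: "'p set \<Rightarrow> bool" where "open_in \<equiv> openin (topol M)"
abbreviation tan where "tan \<equiv> tangent_space M"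
abbreviation vfield where "vfield \<equiv> vector_field_on M"

lemma chart_exists: "x \<in> points M \<Longrightarrow> \<exists>U \<phi>. (U, \<phi>) \<in> atlas M \<and> x \<in> U"
  using smooth_manifold unfolding smooth_manifold_def by blast

lemma open_in_points: "open_in W \<Longrightarrow> x \<in> W \<Longrightarrow> x \<in> points M"
  using openin_subset by blast

lemma chart_homeomorphic:
  "(U, \<phi>) \<in> atlas M \<Longrightarrow> homeomorphic_map (subtopology (topol M) U) (top_of_set (\<phi> ` U)) \<phi>"
  and chart_domain: "(U, \<phi>) \<in> atlas M \<Longrightarrow> open_in U"
  and chart_range: "(U, \<phi>) \<in> atlas M \<Longrightarrow> open (\<phi> ` U)"
  using smooth_manifold unfolding smooth_manifold_def by blast+

lemma chart_inj: "(U, \<phi>) \<in> atlas M \<Longrightarrow> inj_on \<phi> U"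
  using homeomorphic_imp_injective_map[OF chart_homeomorphic] openin_subset[OF chart_domain]
  by (simp add: Int_absorb1)

lemma chart_inv: "(U, \<phi>) \<in> atlas M \<Longrightarrow> x \<in> U \<Longrightarrow> inv_into U \<phi> (\<phi> x) = x"
  using chart_inj by simp

lemma chart_image_open:
  assumes "(U, \<phi>) \<in> atlas M" "open_in W"
  shows "open (\<phi> ` (U \<inter> W))"
proof -
  have "openin (top_of_set (\<phi> ` U)) (\<phi> ` (U \<inter> W))"
    using homeomorphic_imp_open_map[OF chart_homeomorphic[OF assms(1)]] assms(2)
    by (auto simp: open_map_def openin_subtopology_Int2)
  then show ?thesis
    using openin_open_eq[OF chart_range[OF assms(1)]] by blast
qed

lemma transition_smooth:
  "(U, \<phi>) \<in> atlas M \<Longrightarrow> (V, \<psi>) \<in> atlas M \<Longrightarrow> smooth_on (\<phi> ` (U \<inter> V)) (\<psi> \<circ> inv_into U \<phi>)"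
  using smooth_manifold unfolding smooth_manifold_def by fast

lemma smooth_fun_subset: "smooth_fun M W f \<Longrightarrow> W' \<subseteq> W \<Longrightarrow> smooth_fun M W' f"
  unfolding smooth_fun_def by (fast intro: smooth_on_subset)

lemma smooth_fun_cong:
  assumes "open_in W" "\<And>x. x \<in> W \<Longrightarrow> f x = g x" "smooth_fun M W f"
  shows "smooth_fun M W g"
  unfolding smooth_fun_def
proof clarify
  fix U \<phi> assume c: "(U, \<phi>) \<in> atlas M"
  show "smooth_on (\<phi> ` (U \<inter> W)) (g \<circ> inv_into U \<phi>)"
    by (rule smooth_on_cong[OF chart_image_open[OF c assms(1)], of "f \<circ> inv_into U \<phi>"])
      (use assms c in \<open>auto simp: chart_inv smooth_fun_def\<close>)
qed

lemma smooth_fun_const: "smooth_fun M W (\<lambda>x. c)"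
  by (auto simp: smooth_fun_def comp_def smooth_on_const)

lemma smooth_fun_add:
  "open_in W \<Longrightarrow> smooth_fun M W f \<Longrightarrow> smooth_fun M W g \<Longrightarrow> smooth_fun M W (\<lambda>x. f x + g x)"
  unfolding smooth_fun_def comp_def by (fast intro: smooth_on_add chart_image_open)

lemma smooth_fun_mult:
  "open_in W \<Longrightarrow> smooth_fun M W f \<Longrightarrow> smooth_fun M W g \<Longrightarrow> smooth_fun M W (\<lambda>x. f x * g x)"
  unfolding smooth_fun_def comp_def by (fast intro: smooth_on_mult chart_image_open)

lemma smooth_fun_minus: "open_in W \<Longrightarrow> smooth_fun M W f \<Longrightarrow> smooth_fun M W (\<lambda>x. - f x)"
  using smooth_fun_mult[OF _ smooth_fun_const[of W "-1"], of f] by simp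

text \<open>Smoothness need only be checked in one chart, because the transition maps are smooth.\<close>

lemma smooth_fun_one_chart:
  assumes c: "(U, \<phi>) \<in> atlas M" and W: "open_in W" "W \<subseteq> U"
    and f: "smooth_on (\<phi> ` W) (f \<circ> inv_into U \<phi>)"
  shows "smooth_fun M W f"
  unfolding smooth_fun_def
proof clarify
  fix V \<psi> assume d: "(V, \<psi>) \<in> atlas M"
  let ?S = "\<psi> ` (V \<inter> W)"
  have S: "open ?S" using chart_image_open[OF d W(1)] .
  have "smooth_on ?S (\<phi> \<circ> inv_into V \<psi>)"
    using transition_smooth[OF d c] W(2) by (auto intro: smooth_on_subset)
  moreover have "(\<phi> \<circ> inv_into V \<psi>) ` ?S \<subseteq> \<phi> ` W"
    using d by (auto simp: chart_inv)
  ultimately have "smooth_on ?S (\<lambda>y. (f \<circ> inv_into U \<phi>) ((\<phi> \<circ> inv_into V \<psi>) y))"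
    using smooth_on_compose[OF S _ f] by blast
  then show "smooth_on ?S (f \<circ> inv_into V \<psi>)"
    by (rule smooth_on_cong[OF S, rotated]) (use W c d in \<open>auto simp: chart_inv\<close>)
qed

lemma smooth_nearI: "open_in W \<Longrightarrow> x \<in> W \<Longrightarrow> smooth_fun M W f \<Longrightarrow> smooth_near M x f"
  unfolding smooth_near_def by blast

lemma smooth_near_cong:
  assumes "open_in W" "x \<in> W" "\<And>y. y \<in> W \<Longrightarrow> f y = g y" "smooth_near M x f"
  shows "smooth_near M x g"
proof -
  obtain W' where W': "open_in W'" "x \<in> W'" "smooth_fun M W' f"
    using assms(4) by (auto simp: smooth_near_def)
  have "smooth_fun M (W \<inter> W') g"
    by (rule smooth_fun_cong[of _ f])
      (use assms W' in \<open>auto intro: smooth_fun_subset openin_Int\<close>)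
  then show ?thesis
    using assms(1,2) W' by (intro smooth_nearI[of "W \<inter> W'"]) auto
qed

lemma smooth_near_differentiable:
  assumes c: "(U, \<phi>) \<in> atlas M" "x \<in> U" and f: "smooth_near M x f"
  shows "(f \<circ> inv_into U \<phi>) differentiable (at (\<phi> x))"
proof -
  obtain W where W: "x \<in> W" "smooth_fun M W f"
    using f by (auto simp: smooth_near_def)
  then have "smooth_on (\<phi> ` (U \<inter> W)) (f \<circ> inv_into U \<phi>)"
    using c by (auto simp: smooth_fun_def)
  then show ?thesis using W c by (intro smooth_on_imp_differentiable) auto
qed

lemma act_coord_vector:
  "act (coord_vector M x U \<phi> u) f =
    (if smooth_near M x f then frechet_derivative (f \<circ> inv_into U \<phi>) (at (\<phi> x)) u else 0)"
  by (simp add: coord_vector_def)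

lemma coord_vector_linear:
  assumes "(U, \<phi>) \<in> atlas M" "x \<in> U"
  shows "linear (coord_vector M x U \<phi>)"
proof -
  have "linear (frechet_derivative (f \<circ> inv_into U \<phi>) (at (\<phi> x)))" if "smooth_near M x f" for f
    using smooth_near_differentiable[OF assms that] by (rule linear_frechet_derivative)
  then show ?thesis
    by (intro linearI tangent_eqI) (auto simp: act_coord_vector linear_add linear_scale)
qed

lemma coordinate_smooth:
  assumes "(U, \<phi>) \<in> atlas M"
  shows "smooth_fun M U (\<lambda>y. \<phi> y $ i)"
proof (rule smooth_fun_one_chart[OF assms chart_domain[OF assms] order.refl])
  have "smooth_on (\<phi> ` U) (\<lambda>y. y $ i)"
    using smooth_on_bounded_linear[OF chart_range[OF assms] bounded_linear_vec_nth smooth_on_id] .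
  then show "smooth_on (\<phi> ` U) ((\<lambda>y. \<phi> y $ i) \<circ> inv_into U \<phi>)"
    by (rule smooth_on_cong[OF chart_range[OF assms], rotated]) (auto simp: chart_inv[OF assms])
qed

lemma act_coordinate:
  assumes c: "(U, \<phi>) \<in> atlas M" "x \<in> U"
  shows "act (coord_vector M x U \<phi> u) (\<lambda>y. \<phi> y $ i) = u $ i"
proof -
  have "smooth_near M x (\<lambda>y. \<phi> y $ i)"
    using c chart_domain coordinate_smooth by (intro smooth_nearI[of U]) auto
  moreover have "frechet_derivative ((\<lambda>y. \<phi> y $ i) \<circ> inv_into U \<phi>) (at (\<phi> x))
      = frechet_derivative (\<lambda>y. y $ i) (at (\<phi> x))"
    by (rule frechet_derivative_cong_open[OF chart_range[OF c(1)]]) (use c in \<open>auto simp: chart_inv\<close>)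
  moreover have "frechet_derivative (\<lambda>y::real^'n. y $ i) (at (\<phi> x)) = (\<lambda>y. y $ i)"
    using frechet_derivative_at[OF bounded_linear_imp_has_derivative[OF bounded_linear_vec_nth]] by metis
  ultimately show ?thesis by (simp add: act_coord_vector)
qed

lemma coord_vector_inj:
  assumes "(U, \<phi>) \<in> atlas M" "x \<in> U"
  shows "inj (coord_vector M x U \<phi>)"
  using act_coordinate[OF assms] by (metis injI vec_eq_iff)

text \<open>By the chain rule, the components in two charts differ by the derivative of the transition map;
  hence every chart at \<open>x\<close> describes the whole tangent space.\<close>

lemma coord_vector_change:
  assumes c: "(U, \<phi>) \<in> atlas M" "x \<in> U" and d: "(V, \<psi>) \<in> atlas M" "x \<in> V"
  shows "coord_vector M x V \<psi> u
    = coord_vector M x U \<phi> (frechet_derivative (\<phi> \<circ> inv_into V \<psi>) (at (\<psi> x)) u)"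
proof (rule tangent_eqI)
  fix f
  let ?S = "\<psi> ` (V \<inter> U)"
  show "act (coord_vector M x V \<psi> u) f
    = act (coord_vector M x U \<phi> (frechet_derivative (\<phi> \<circ> inv_into V \<psi>) (at (\<psi> x)) u)) f"
  proof (cases "smooth_near M x f")
    case True
    have S: "open ?S" "\<psi> x \<in> ?S" using chart_image_open[OF d(1) chart_domain[OF c(1)]] c d by auto
    have "(\<phi> \<circ> inv_into V \<psi>) differentiable (at (\<psi> x))"
      using transition_smooth[OF d(1) c(1)] S(2) by (rule smooth_on_imp_differentiable)
    moreover have "(f \<circ> inv_into U \<phi>) differentiable (at ((\<phi> \<circ> inv_into V \<psi>) (\<psi> x)))"
      using smooth_near_differentiable[OF c True] d by (simp add: chart_inv)
    ultimately have "frechet_derivative ((f \<circ> inv_into U \<phi>) \<circ> (\<phi> \<circ> inv_into V \<psi>)) (at (\<psi> x))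
      = frechet_derivative (f \<circ> inv_into U \<phi>) (at ((\<phi> \<circ> inv_into V \<psi>) (\<psi> x)))
        \<circ> frechet_derivative (\<phi> \<circ> inv_into V \<psi>) (at (\<psi> x))"
      by (intro frechet_derivative_compose)
    moreover have "frechet_derivative ((f \<circ> inv_into U \<phi>) \<circ> (\<phi> \<circ> inv_into V \<psi>)) (at (\<psi> x))
      = frechet_derivative (f \<circ> inv_into V \<psi>) (at (\<psi> x))"
      by (rule frechet_derivative_cong_open[OF S]) (use c d in \<open>auto simp: chart_inv\<close>)
    ultimately show ?thesis using d by (simp add: act_coord_vector chart_inv)
  qed (simp add: act_coord_vector)
qed

lemma tangent_space_chart:
  assumes c: "(U, \<phi>) \<in> atlas M" "x \<in> U"
  shows "tan x = range (coord_vector M x U \<phi>)"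
  using coord_vector_change[OF c] c unfolding tangent_space_def by blast

lemma tangent_space_subspace: "x \<in> points M \<Longrightarrow> subspace (tan x)"
  using chart_exists tangent_space_chart coord_vector_linear
  by (metis linear_subspace_image subspace_UNIV)

lemma tangent_coord: "v \<in> tan x \<Longrightarrow> \<exists>U \<phi> u. (U, \<phi>) \<in> atlas M \<and> x \<in> U \<and> v = coord_vector M x U \<phi> u"
  unfolding tangent_space_def by blast

lemma act_cong:
  assumes v: "v \<in> tan x" and W: "open_in W" "x \<in> W" and eq: "\<And>y. y \<in> W \<Longrightarrow> f y = g y"
  shows "act v f = act v g"
proof -
  obtain U \<phi> u where c: "(U, \<phi>) \<in> atlas M" "x \<in> U" and v_def: "v = coord_vector M x U \<phi> u"
    using tangent_coord[OF v] by blast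
  have "smooth_near M x f \<longleftrightarrow> smooth_near M x g"
    using smooth_near_cong[OF W, of f g] smooth_near_cong[OF W, of g f] eq by auto
  moreover have "frechet_derivative (f \<circ> inv_into U \<phi>) (at (\<phi> x))
      = frechet_derivative (g \<circ> inv_into U \<phi>) (at (\<phi> x))"
    by (rule frechet_derivative_cong_open[OF chart_image_open[OF c(1) W(1)]])
      (use c W eq in \<open>auto simp: chart_inv\<close>)
  ultimately show ?thesis by (simp add: v_def act_coord_vector)
qed

lemma act_const: "v \<in> tan x \<Longrightarrow> act v (\<lambda>y. c) = 0"
  using tangent_coord[of v x]
  by (auto simp: act_coord_vector comp_def frechet_derivative_const)

lemma act_add_mult:
  assumes v: "v \<in> tan x" and W: "open_in W" "x \<in> W"
    and f: "smooth_fun M W f" and g: "smooth_fun M W g"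
  shows "act v (\<lambda>y. f y + g y) = act v f + act v g"
    and "act v (\<lambda>y. f y * g y) = f x * act v g + act v f * g x"
proof -
  obtain U \<phi> u where c: "(U, \<phi>) \<in> atlas M" "x \<in> U" and v_def: "v = coord_vector M x U \<phi> u"
    using tangent_coord[OF v] by blast
  have near: "smooth_near M x f" "smooth_near M x g"
    "smooth_near M x (\<lambda>y. f y + g y)" "smooth_near M x (\<lambda>y. f y * g y)"
    using W f g by (auto intro!: smooth_nearI[of W] smooth_fun_add smooth_fun_mult)
  note D = near(1,2)[THEN smooth_near_differentiable[OF c], unfolded frechet_derivative_works]
  show "act v (\<lambda>y. f y + g y) = act v f + act v g"
    using fun_cong[OF frechet_derivative_at[OF has_derivative_add[OF D]], of u] near
    by (simp add: v_def act_coord_vector comp_def)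
  show "act v (\<lambda>y. f y * g y) = f x * act v g + act v f * g x"
    using fun_cong[OF frechet_derivative_at[OF has_derivative_mult[OF D]], of u] near c
    by (simp add: v_def act_coord_vector comp_def chart_inv)
qed

lemmas act_add = act_add_mult(1)
lemmas act_mult = act_add_mult(2)

lemma act_minus:
  assumes "v \<in> tan x" "open_in W" "x \<in> W" "smooth_fun M W f"
  shows "act v (\<lambda>y. - f y) = - act v f"
  using act_mult[OF assms(1-3) smooth_fun_const[of W "-1"] assms(4)] act_const[OF assms(1)]
  by simp

lemma act_diff:
  assumes "v \<in> tan x" "open_in W" "x \<in> W" "smooth_fun M W f" "smooth_fun M W g"
  shows "act v (\<lambda>y. f y - g y) = act v f - act v g"
  using act_add[OF assms(1-4) smooth_fun_minus[OF assms(2,5)]] act_minus[OF assms(1-3,5)]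
  by simp

lemma vfield_tan: "vfield W X \<Longrightarrow> x \<in> W \<Longrightarrow> X x \<in> tan x"
  unfolding vector_field_on_def by blast

lemma vfield_act_smooth: "open_in W \<Longrightarrow> vfield W X \<Longrightarrow> smooth_fun M W f \<Longrightarrow> smooth_fun M W (\<lambda>x. act (X x) f)"
  unfolding vector_field_on_def by blast

lemma vfield_subset: "vfield W X \<Longrightarrow> W' \<subseteq> W \<Longrightarrow> vfield W' X"
  unfolding vector_field_on_def by blast

lemma vfield_cong:
  assumes eq: "\<And>x. x \<in> W \<Longrightarrow> X x = Y x" and X: "vfield W X"
  shows "vfield W Y"
  unfolding vector_field_on_def
proof (intro conjI ballI allI impI)
  show "Y x \<in> tan x" if "x \<in> W" for x
    using vfield_tan[OF X that] eq[OF that] by simp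
  show "smooth_fun M W' (\<lambda>x. act (Y x) f)"
    if "open_in W' \<and> W' \<subseteq> W \<and> smooth_fun M W' f" for W' f
    by (rule smooth_fun_cong[of _ "\<lambda>x. act (X x) f"])
      (use that eq vfield_act_smooth vfield_subset[OF X] in auto)
qed

lemma vfield_add:
  assumes "open_in W" "vfield W X" "vfield W Y"
  shows "vfield W (\<lambda>x. X x + Y x)"
  using assms tangent_space_subspace open_in_points unfolding vector_field_on_def
  by (auto intro!: smooth_fun_add subspace_add)

lemma vfield_scale:
  assumes "open_in W" "smooth_fun M W f" "vfield W X"
  shows "vfield W (\<lambda>x. f x *\<^sub>R X x)"
  using assms tangent_space_subspace open_in_points unfolding vector_field_on_def
  by (auto intro!: smooth_fun_mult subspace_scale elim: smooth_fun_subset)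

lemma vfield_minus: "open_in W \<Longrightarrow> vfield W X \<Longrightarrow> vfield W (\<lambda>x. - X x)"
  using vfield_scale[OF _ smooth_fun_const[of W "-1"], of X] by simp

lemma vfield_diff: "open_in W \<Longrightarrow> vfield W X \<Longrightarrow> vfield W Y \<Longrightarrow> vfield W (\<lambda>x. X x - Y x)"
  using vfield_add[of W X "\<lambda>x. - Y x"] vfield_minus by simp

lemma vfield_zero: "open_in W \<Longrightarrow> vfield W (\<lambda>x. 0)"
  using tangent_space_subspace open_in_points smooth_fun_const unfolding vector_field_on_def
  by (auto intro: subspace_0)

lemma vfield_sum:
  assumes "open_in W" "\<And>i. i \<in> I \<Longrightarrow> vfield W (X i)"
  shows "vfield W (\<lambda>x. \<Sum>i\<in>I. X i x)"
  using assms(2)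
  by (induction I rule: infinite_finite_induct)
    (auto intro: vfield_zero[OF assms(1)] vfield_add[OF assms(1)])

definition frame :: "'p set \<Rightarrow> ('p \<Rightarrow> real ^ 'n) \<Rightarrow> 'n \<Rightarrow> 'p \<Rightarrow> 'p tangent" where
  "frame U \<phi> i x = coord_vector M x U \<phi> (axis i 1)"

lemma coord_vector_vfield:
  assumes c: "(U, \<phi>) \<in> atlas M"
  shows "vfield U (\<lambda>x. coord_vector M x U \<phi> u)"
  unfolding vector_field_on_def
proof (intro conjI ballI allI impI)
  show "coord_vector M x U \<phi> u \<in> tan x" if "x \<in> U" for x
    using tangent_space_chart[OF c that] by blast
  fix W f assume "open_in W \<and> W \<subseteq> U \<and> smooth_fun M W f"
  then have W: "open_in W" "W \<subseteq> U" and f: "smooth_fun M W f" by auto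
  have "U \<inter> W = W" using W by blast
  then have op: "open (\<phi> ` W)" and s: "smooth_on (\<phi> ` W) (f \<circ> inv_into U \<phi>)"
    using chart_image_open[OF c W(1)] f c by (auto simp: smooth_fun_def)
  show "smooth_fun M W (\<lambda>x. act (coord_vector M x U \<phi> u) f)"
  proof (rule smooth_fun_one_chart[OF c W])
    show "smooth_on (\<phi> ` W) ((\<lambda>x. act (coord_vector M x U \<phi> u) f) \<circ> inv_into U \<phi>)"
      by (rule smooth_on_cong[OF op _ smooth_on_frechet_derivative[OF s, of u]])
        (use W f in \<open>auto simp: chart_inv[OF c subsetD[OF W(2)]] act_coord_vector
            dest: smooth_nearI\<close>)
  qed
qed

lemma frame_vfield: "(U, \<phi>) \<in> atlas M \<Longrightarrow> vfield U (frame U \<phi> i)"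
  using coord_vector_vfield[of U \<phi> "axis i 1"] by (simp add: frame_def[abs_def])

lemma tangent_frame_expand:
  assumes c: "(U, \<phi>) \<in> atlas M" "x \<in> U" and v: "v \<in> tan x"
  shows "v = (\<Sum>i\<in>UNIV. act v (\<lambda>y. \<phi> y $ i) *\<^sub>R frame U \<phi> i x)"
proof -
  obtain u where u: "v = coord_vector M x U \<phi> u"
    using v tangent_space_chart[OF c] by blast
  also have "\<dots> = coord_vector M x U \<phi> (\<Sum>i\<in>UNIV. u $ i *\<^sub>R axis i 1)"
    by (metis basis_expansion scalar_mult_eq_scaleR)
  also have "\<dots> = (\<Sum>i\<in>UNIV. u $ i *\<^sub>R frame U \<phi> i x)"
    using coord_vector_linear[OF c] by (simp add: linear_sum linear_scale frame_def)
  also have "\<dots> = (\<Sum>i\<in>UNIV. act v (\<lambda>y. \<phi> y $ i) *\<^sub>R frame U \<phi> i x)"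
    unfolding u act_coordinate[OF c] ..
  finally show ?thesis .
qed

text \<open>The fields with constant components in a chart extend all tangent vectors at \<open>x\<close> to one common
  neighbourhood.\<close>

lemma vfield_extension:
  assumes "x \<in> points M"
  shows "\<exists>W. open_in W \<and> x \<in> W \<and> (\<forall>u\<in>tan x. \<exists>X. vfield W X \<and> X x = u)"
proof -
  obtain U \<phi> where c: "(U, \<phi>) \<in> atlas M" "x \<in> U" using chart_exists assms by blast
  then show ?thesis
    using coord_vector_vfield[OF c(1)] chart_domain[OF c(1)] tangent_space_chart[OF c]
    by (intro exI[of _ U]) (auto intro: exI[of _ "\<lambda>x. coord_vector M x U \<phi> y" for y])
qed

lemma extend_vector:
  assumes "x \<in> points M" "u \<in> tan x"
  shows "extend_vector M x u x = u"
    and "\<exists>W. open_in W \<and> x \<in> W \<and> vfield W (extend_vector M x u)"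
proof -
  have "\<exists>X. X x = u \<and> (\<exists>W. open_in W \<and> x \<in> W \<and> vfield W X)"
    using vfield_extension[OF assms(1)] assms(2) by blast
  from someI_ex[OF this] show "extend_vector M x u x = u"
    and "\<exists>W. open_in W \<and> x \<in> W \<and> vfield W (extend_vector M x u)"
    by (auto simp: extend_vector_def)
qed

text \<open>An assignment on vector fields that is local, additive and linear over functions at \<open>x\<close>
  sees only the value at \<open>x\<close>: near \<open>x\<close> a field is a combination of the coordinate fields, and
  the coefficients are evaluated at \<open>x\<close>.\<close>

lemma tensorial:
  fixes \<Phi> :: "('p \<Rightarrow> 'p tangent) \<Rightarrow> 'v::real_vector"
  assumes W: "open_in W" "x \<in> W"
    and cong: "\<And>W' X Y. \<lbrakk>open_in W'; x \<in> W'; W' \<subseteq> W; vfield W' X; vfield W' Y;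
        \<And>y. y \<in> W' \<Longrightarrow> X y = Y y\<rbrakk> \<Longrightarrow> \<Phi> X = \<Phi> Y"
    and add: "\<And>W' X Y. \<lbrakk>open_in W'; x \<in> W'; W' \<subseteq> W; vfield W' X; vfield W' Y\<rbrakk>
        \<Longrightarrow> \<Phi> (\<lambda>y. X y + Y y) = \<Phi> X + \<Phi> Y"
    and scale: "\<And>W' X f. \<lbrakk>open_in W'; x \<in> W'; W' \<subseteq> W; vfield W' X; smooth_fun M W' f\<rbrakk>
        \<Longrightarrow> \<Phi> (\<lambda>y. f y *\<^sub>R X y) = f x *\<^sub>R \<Phi> X"
    and X: "vfield W X" and Y: "vfield W Y" and eq: "X x = Y x"
  shows "\<Phi> X = \<Phi> Y"
proof -
  obtain U \<phi> where c: "(U, \<phi>) \<in> atlas M" "x \<in> U"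
    using chart_exists open_in_points[OF W] by blast
  define W' where "W' = W \<inter> U"
  have W': "open_in W'" "x \<in> W'" "W' \<subseteq> W" "W' \<subseteq> U"
    using W c chart_domain[OF c(1)] by (auto simp: W'_def)
  have E: "vfield W' (frame U \<phi> i)" for i
    using frame_vfield[OF c(1)] W'(4) by (rule vfield_subset)
  have "\<Phi> Z = (\<Sum>i\<in>UNIV. act (Z x) (\<lambda>y. \<phi> y $ i) *\<^sub>R \<Phi> (frame U \<phi> i))" if "vfield W Z" for Z
  proof -
    have Z: "vfield W' Z" using that W'(3) by (rule vfield_subset)
    define f where "f i y = act (Z y) (\<lambda>y. \<phi> y $ i)" for i y
    have f: "smooth_fun M W' (f i)" for i
      unfolding f_def
      using vfield_act_smooth[OF W'(1) Z] smooth_fun_subset[OF coordinate_smooth[OF c(1)] W'(4)] by blast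
    have fE: "vfield W' (\<lambda>y. f i y *\<^sub>R frame U \<phi> i y)" for i
      using vfield_scale[OF W'(1) f E] .
    have "\<Phi> (\<lambda>y. \<Sum>i\<in>I. f i y *\<^sub>R frame U \<phi> i y) = (\<Sum>i\<in>I. f i x *\<^sub>R \<Phi> (frame U \<phi> i))"
      if "finite I" for I
      using that
    proof (induction I)
      case empty
      show ?case using scale[OF W'(1-3) Z smooth_fun_const[of _ 0]] by simp
    next
      case (insert j I)
      have "vfield W' (\<lambda>y. \<Sum>i\<in>I. f i y *\<^sub>R frame U \<phi> i y)"
        using fE by (intro vfield_sum[OF W'(1)])
      then show ?case
        using insert add[OF W'(1-3) fE[of j]] scale[OF W'(1-3) E f] by simp
    qed
    moreover have "\<Phi> Z = \<Phi> (\<lambda>y. \<Sum>i\<in>UNIV. f i y *\<^sub>R frame U \<phi> i y)"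
    proof (rule cong[OF W'(1-3) Z vfield_sum[OF W'(1) fE]])
      show "Z y = (\<Sum>i\<in>UNIV. f i y *\<^sub>R frame U \<phi> i y)" if "y \<in> W'" for y
        unfolding f_def using tangent_frame_expand[OF c(1)] W'(4) vfield_tan[OF Z] that by blast
    qed
    ultimately show ?thesis by (simp add: f_def)
  qed
  then show ?thesis using X Y eq by simp
qed

lemma act_lie_bracket:
  "smooth_near M x f \<Longrightarrow>
    act (lie_bracket M X Y x) f = act (X x) (\<lambda>y. act (Y y) f) - act (Y x) (\<lambda>y. act (X y) f)"
  by (simp add: lie_bracket_def)

end

section \<open>The curvature tensor of the Levi-Civita connection\<close>

locale semi_riemannian = manifold M for M :: "('p, 'n::finite) mfd" +
  fixes g :: "'p \<Rightarrow> 'p tangent \<Rightarrow> 'p tangent \<Rightarrow> real" and D :: "'p connection"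
  assumes metric: "semi_riemannian_metric M g" and levi_civita: "levi_civita M g D"
begin

abbreviation lie where "lie \<equiv> lie_bracket M"
abbreviation R where "R \<equiv> curvature_fields M D"

lemma connection: "affine_connection M D"
  using levi_civita by (simp add: levi_civita_def)

lemma D_vfield: "open_in W \<Longrightarrow> vfield W X \<Longrightarrow> vfield W Y \<Longrightarrow> vfield W (D X Y)"
  using connection[unfolded affine_connection_def, rule_format, of W] by simp

lemma D_add_left: "open_in W \<Longrightarrow> x \<in> W \<Longrightarrow> vfield W X \<Longrightarrow> vfield W X' \<Longrightarrow> vfield W Y \<Longrightarrow>
    D (\<lambda>y. X y + X' y) Y x = D X Y x + D X' Y x"
  and D_add_right: "open_in W \<Longrightarrow> x \<in> W \<Longrightarrow> vfield W X \<Longrightarrow> vfield W X' \<Longrightarrow> vfield W Y \<Longrightarrow>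
    D Y (\<lambda>y. X y + X' y) x = D Y X x + D Y X' x"
  using connection[unfolded affine_connection_def, rule_format, of W] by simp_all

lemma D_scale_left: "open_in W \<Longrightarrow> x \<in> W \<Longrightarrow> smooth_fun M W f \<Longrightarrow> vfield W X \<Longrightarrow> vfield W Y \<Longrightarrow>
    D (\<lambda>y. f y *\<^sub>R X y) Y x = f x *\<^sub>R D X Y x"
  and D_scale_right: "open_in W \<Longrightarrow> x \<in> W \<Longrightarrow> smooth_fun M W f \<Longrightarrow> vfield W X \<Longrightarrow> vfield W Y \<Longrightarrow>
    D X (\<lambda>y. f y *\<^sub>R Y y) x = f x *\<^sub>R D X Y x + act (X x) f *\<^sub>R Y x"
  using connection[unfolded affine_connection_def, rule_format, of W] by simp_all

lemma D_minus_left: "open_in W \<Longrightarrow> x \<in> W \<Longrightarrow> vfield W X \<Longrightarrow> vfield W Y \<Longrightarrow>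
    D (\<lambda>y. - X y) Y x = - D X Y x"
  using D_scale_left[of W x "\<lambda>_. -1" X Y] smooth_fun_const by simp

lemma D_minus_right:
  assumes "open_in W" "x \<in> W" "vfield W X" "vfield W Y"
  shows "D X (\<lambda>y. - Y y) x = - D X Y x"
  using D_scale_right[OF assms(1,2) smooth_fun_const[of W "-1"] assms(3,4)]
    act_const[OF vfield_tan[OF assms(3,2)]] by simp

lemma D_diff_left: "open_in W \<Longrightarrow> x \<in> W \<Longrightarrow> vfield W X \<Longrightarrow> vfield W X' \<Longrightarrow> vfield W Y \<Longrightarrow>
    D (\<lambda>y. X y - X' y) Y x = D X Y x - D X' Y x"
  using D_add_left[of W x X "\<lambda>y. - X' y" Y] by (simp add: D_minus_left vfield_minus)

lemma D_diff_right: "open_in W \<Longrightarrow> x \<in> W \<Longrightarrow> vfield W X \<Longrightarrow> vfield W X' \<Longrightarrow> vfield W Y \<Longrightarrow>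
    D Y (\<lambda>y. X y - X' y) x = D Y X x - D Y X' x"
  using D_add_right[of W x X "\<lambda>y. - X' y" Y] by (simp add: D_minus_right vfield_minus)

text \<open>Locality comes from the rules for multiplication by functions: a field that vanishes on \<open>W\<close> is
  unchanged by multiplication with the function that is \<open>0\<close> on \<open>W\<close> and \<open>1\<close> elsewhere, and this
  function is smooth on \<open>W\<close>.\<close>

lemma D_local:
  assumes W: "open_in W" "x \<in> W" and X: "vfield W X" and Y: "vfield W Y"
    and zero: "\<And>y. y \<in> W \<Longrightarrow> X y = 0"
  shows "D X Y x = 0" and "D Y X x = 0"
proof -
  define f where "f y = (if y \<in> W then 0 else 1 :: real)" for y
  have f: "smooth_fun M W f"
    by (rule smooth_fun_cong[OF W(1) _ smooth_fun_const[of W 0]]) (simp add: f_def)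
  have fX: "(\<lambda>y. f y *\<^sub>R X y) = X"
    using zero by (auto simp: f_def)
  show "D X Y x = 0"
    using D_scale_left[OF W f X Y] W unfolding fX by (simp add: f_def)
  show "D Y X x = 0"
    using D_scale_right[OF W f Y X] W zero unfolding fX by (simp add: f_def)
qed

lemma D_cong:
  assumes W: "open_in W" "x \<in> W"
    and X: "vfield W X" "vfield W X'" "\<And>y. y \<in> W \<Longrightarrow> X y = X' y"
    and Y: "vfield W Y" "vfield W Y'" "\<And>y. y \<in> W \<Longrightarrow> Y y = Y' y"
  shows "D X Y x = D X' Y' x"
proof -
  have "D (\<lambda>y. X y - X' y) Y x = 0" "D X' (\<lambda>y. Y y - Y' y) x = 0"
    using D_local(1)[OF W vfield_diff[OF W(1) X(1,2)] Y(1)]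
      D_local(2)[OF W vfield_diff[OF W(1) Y(1,2)] X(2)] X(3) Y(3) by auto
  then show ?thesis
    using D_diff_left[OF W X(1,2) Y(1)] D_diff_right[OF W Y(1,2) X(2)] by simp
qed

lemma torsion_free: "open_in W \<Longrightarrow> x \<in> W \<Longrightarrow> vfield W X \<Longrightarrow> vfield W Y \<Longrightarrow>
    lie X Y x = D X Y x - D Y X x"
  using conjunct2[OF levi_civita[unfolded levi_civita_def], rule_format, of W] by simp

lemma metric_compatible: "open_in W \<Longrightarrow> x \<in> W \<Longrightarrow> vfield W X \<Longrightarrow> vfield W Y \<Longrightarrow> vfield W Z \<Longrightarrow>
    act (X x) (\<lambda>y. g y (Y y) (Z y)) = g x (D X Y x) (Z x) + g x (Y x) (D X Z x)"
  using conjunct2[OF levi_civita[unfolded levi_civita_def], rule_format, of W] by simp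

text \<open>Since the connection is torsion free, the bracket is a difference of covariant derivatives;
  smoothness and locality are inherited from these.\<close>

lemma lie_vfield:
  assumes "open_in W" "vfield W X" "vfield W Y"
  shows "vfield W (lie X Y)"
  by (rule vfield_cong[OF _ vfield_diff[OF assms(1) D_vfield[OF assms] D_vfield[OF assms(1,3,2)]]])
    (use assms torsion_free in auto)

lemma R_eq: "R X Y Z x = D X (D Y Z) x - D Y (D X Z) x - D (lie X Y) Z x"
  by (simp add: curvature_fields_def)

lemma R_cong:
  assumes W: "open_in W" "x \<in> W"
    and X: "vfield W X" "vfield W X'" "\<And>y. y \<in> W \<Longrightarrow> X y = X' y"
    and Y: "vfield W Y" "vfield W Y'" "\<And>y. y \<in> W \<Longrightarrow> Y y = Y' y"
    and Z: "vfield W Z" "vfield W Z'" "\<And>y. y \<in> W \<Longrightarrow> Z y = Z' y"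
  shows "R X Y Z x = R X' Y' Z' x"
proof -
  note D_vf = D_vfield[OF W(1)]
  have DXZ: "D X Z y = D X' Z' y" and DYZ: "D Y Z y = D Y' Z' y"
    and lie: "lie X Y y = lie X' Y' y" if "y \<in> W" for y
    using D_cong[OF W(1) that X Z] D_cong[OF W(1) that Y Z]
      D_cong[OF W(1) that X Y] D_cong[OF W(1) that Y X]
      torsion_free[OF W(1) that X(1) Y(1)] torsion_free[OF W(1) that X(2) Y(2)] by auto
  have "D X (D Y Z) x = D X' (D Y' Z') x"
    by (rule D_cong[OF W X D_vf[OF Y(1) Z(1)] D_vf[OF Y(2) Z(2)] DYZ])
  moreover have "D Y (D X Z) x = D Y' (D X' Z') x"
    by (rule D_cong[OF W Y D_vf[OF X(1) Z(1)] D_vf[OF X(2) Z(2)] DXZ])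
  moreover have "D (lie X Y) Z x = D (lie X' Y') Z' x"
    by (rule D_cong[OF W lie_vfield[OF W(1) X(1) Y(1)] lie_vfield[OF W(1) X(2) Y(2)] lie Z])
  ultimately show ?thesis by (simp add: R_eq)
qed

lemma R_antisym:
  assumes W: "open_in W" "x \<in> W" and X: "vfield W X" and Y: "vfield W Y" and Z: "vfield W Z"
  shows "R X Y Z x = - R Y X Z x"
proof -
  note lie_vf = lie_vfield[OF W(1)]
  have "D (lie X Y) Z x = D (\<lambda>y. - lie Y X y) Z x"
    by (rule D_cong[OF W lie_vf[OF X Y] vfield_minus[OF W(1) lie_vf[OF Y X]] _ Z Z refl])
      (use torsion_free[OF W(1)] X Y in auto)
  then show ?thesis
    using D_minus_left[OF W lie_vf[OF Y X] Z] by (simp add: R_eq)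
qed

lemma R_add_1:
  assumes W: "open_in W" "x \<in> W"
    and X: "vfield W X" "vfield W X'" and Y: "vfield W Y" and Z: "vfield W Z"
  shows "R (\<lambda>y. X y + X' y) Y Z x = R X Y Z x + R X' Y Z x"
proof -
  let ?S = "\<lambda>y. X y + X' y"
  note vf = D_vfield[OF W(1)] lie_vfield[OF W(1)] vfield_add[OF W(1)] X Y Z
  have "D Y (D ?S Z) x = D Y (\<lambda>y. D X Z y + D X' Z y) x"
    by (rule D_cong[OF W]) (simp_all add: vf D_add_left[OF W(1)])
  moreover have "D (lie ?S Y) Z x = D (\<lambda>y. lie X Y y + lie X' Y y) Z x"
    by (rule D_cong[OF W])
      (simp_all add: vf torsion_free[OF W(1)] D_add_left[OF W(1)] D_add_right[OF W(1)])
  ultimately show ?thesis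
    by (simp add: vf R_eq D_add_left[OF W] D_add_right[OF W])
qed

lemma R_scale_1:
  assumes W: "open_in W" "x \<in> W" and f: "smooth_fun M W f"
    and X: "vfield W X" and Y: "vfield W Y" and Z: "vfield W Z"
  shows "R (\<lambda>y. f y *\<^sub>R X y) Y Z x = f x *\<^sub>R R X Y Z x"
proof -
  let ?S = "\<lambda>y. f y *\<^sub>R X y"
  note vf = D_vfield[OF W(1)] lie_vfield[OF W(1)] vfield_diff[OF W(1)]
    vfield_scale[OF W(1)] X Y Z f
  have Yf: "smooth_fun M W (\<lambda>y. act (Y y) f)"
    using vfield_act_smooth[OF W(1) Y f] .
  have "D Y (D ?S Z) x = D Y (\<lambda>y. f y *\<^sub>R D X Z y) x"
    by (rule D_cong[OF W]) (simp_all add: vf D_scale_left[OF W(1)])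
  moreover have "D (lie ?S Y) Z x = D (\<lambda>y. f y *\<^sub>R lie X Y y - act (Y y) f *\<^sub>R X y) Z x"
    by (rule D_cong[OF W])
      (simp_all add: vf Yf torsion_free[OF W(1)] D_scale_left[OF W(1)] D_scale_right[OF W(1)]
        scaleR_diff_right)
  ultimately show ?thesis
    by (simp add: vf Yf R_eq D_scale_left[OF W] D_scale_right[OF W] D_diff_left[OF W]
        scaleR_diff_right)
qed

lemma R_add_2:
  assumes W: "open_in W" "x \<in> W"
    and X: "vfield W X" and Y: "vfield W Y" "vfield W Y'" and Z: "vfield W Z"
  shows "R X (\<lambda>y. Y y + Y' y) Z x = R X Y Z x + R X Y' Z x"
  using R_add_1[OF W Y X Z] R_antisym[OF W X _ Z] Y vfield_add[OF W(1) Y] by simp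

lemma R_scale_2:
  assumes W: "open_in W" "x \<in> W" and f: "smooth_fun M W f"
    and X: "vfield W X" and Y: "vfield W Y" and Z: "vfield W Z"
  shows "R X (\<lambda>y. f y *\<^sub>R Y y) Z x = f x *\<^sub>R R X Y Z x"
  using R_scale_1[OF W f Y X Z] R_antisym[OF W X _ Z] Y vfield_scale[OF W(1) f Y] by simp

lemma R_add_3:
  assumes W: "open_in W" "x \<in> W"
    and X: "vfield W X" and Y: "vfield W Y" and Z: "vfield W Z" "vfield W Z'"
  shows "R X Y (\<lambda>y. Z y + Z' y) x = R X Y Z x + R X Y Z' x"
proof -
  let ?S = "\<lambda>y. Z y + Z' y"
  note vf = D_vfield[OF W(1)] lie_vfield[OF W(1)] vfield_add[OF W(1)] X Y Z
  have "D Y (D X ?S) x = D Y (\<lambda>y. D X Z y + D X Z' y) x"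
    by (rule D_cong[OF W]) (simp_all add: vf D_add_right[OF W(1)])
  moreover have "D X (D Y ?S) x = D X (\<lambda>y. D Y Z y + D Y Z' y) x"
    by (rule D_cong[OF W]) (simp_all add: vf D_add_right[OF W(1)])
  ultimately show ?thesis
    by (simp add: vf R_eq D_add_right[OF W])
qed

text \<open>In the last argument the second derivatives \<open>X (Y f) - Y (X f)\<close> of the factor survive, and
  the term with the bracket of \<open>X\<close> and \<open>Y\<close> removes them.\<close>

lemma R_scale_3:
  assumes W: "open_in W" "x \<in> W" and f: "smooth_fun M W f"
    and X: "vfield W X" and Y: "vfield W Y" and Z: "vfield W Z"
  shows "R X Y (\<lambda>y. f y *\<^sub>R Z y) x = f x *\<^sub>R R X Y Z x"
proof -
  let ?S = "\<lambda>y. f y *\<^sub>R Z y"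
  note vf = D_vfield[OF W(1)] lie_vfield[OF W(1)] vfield_add[OF W(1)]
    vfield_scale[OF W(1)] X Y Z f vfield_act_smooth[OF W(1)]
  have "D Y (D X ?S) x = D Y (\<lambda>y. f y *\<^sub>R D X Z y + act (X y) f *\<^sub>R Z y) x"
    by (rule D_cong[OF W]) (simp_all add: vf D_scale_right[OF W(1)])
  moreover have "D X (D Y ?S) x = D X (\<lambda>y. f y *\<^sub>R D Y Z y + act (Y y) f *\<^sub>R Z y) x"
    by (rule D_cong[OF W]) (simp_all add: vf D_scale_right[OF W(1)])
  moreover have "act (X x) (\<lambda>y. act (Y y) f) *\<^sub>R Z x - act (Y x) (\<lambda>y. act (X y) f) *\<^sub>R Z x
      = act (lie X Y x) f *\<^sub>R Z x"
    by (simp add: act_lie_bracket[OF smooth_nearI[OF W f]] scaleR_diff_left)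
  ultimately show ?thesis
    by (simp add: vf R_eq D_scale_right[OF W] D_add_right[OF W] algebra_simps)
qed

lemma R_vfield:
  assumes W: "open_in W" and X: "vfield W X" and Y: "vfield W Y" and Z: "vfield W Z"
  shows "vfield W (R X Y Z)"
proof -
  have "vfield W (\<lambda>x. D X (D Y Z) x - D Y (D X Z) x - D (lie X Y) Z x)"
    using assms by (intro vfield_diff D_vfield lie_vfield)
  then show ?thesis by (simp flip: R_eq)
qed

lemma R_pointwise:
  assumes W: "open_in W" "x \<in> W"
    and X: "vfield W X" "vfield W X'" "X x = X' x"
    and Y: "vfield W Y" "vfield W Y'" "Y x = Y' x"
    and Z: "vfield W Z" "vfield W Z'" "Z x = Z' x"
  shows "R X Y Z x = R X' Y' Z' x"
proof -
  note sub = vfield_subset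
  have "R X Y Z x = R X' Y Z x"
  proof (rule tensorial[OF W, of "\<lambda>X. R X Y Z x"])
    show "R P Y Z x = R Q Y Z x"
      if W': "open_in W'" "x \<in> W'" "W' \<subseteq> W" and P: "vfield W' P" "vfield W' Q"
        and eq: "\<And>y. y \<in> W' \<Longrightarrow> P y = Q y" for W' P Q
      by (rule R_cong[OF W'(1,2)]) (simp_all add: P eq sub[OF _ W'(3)] X Y Z)
    show "R (\<lambda>y. P y + Q y) Y Z x = R P Y Z x + R Q Y Z x"
      if W': "open_in W'" "x \<in> W'" "W' \<subseteq> W" and P: "vfield W' P" "vfield W' Q" for W' P Q
      by (rule R_add_1[OF W'(1,2)]) (simp_all add: P sub[OF _ W'(3)] X Y Z)
    show "R (\<lambda>y. f y *\<^sub>R P y) Y Z x = f x *\<^sub>R R P Y Z x"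
      if W': "open_in W'" "x \<in> W'" "W' \<subseteq> W" and P: "vfield W' P" "smooth_fun M W' f" for W' P f
      by (rule R_scale_1[OF W'(1,2)]) (simp_all add: P sub[OF _ W'(3)] X Y Z)
  qed (use X in simp_all)
  also have "\<dots> = R X' Y' Z x"
  proof (rule tensorial[OF W, of "\<lambda>Y. R X' Y Z x"])
    show "R X' P Z x = R X' Q Z x"
      if W': "open_in W'" "x \<in> W'" "W' \<subseteq> W" and P: "vfield W' P" "vfield W' Q"
        and eq: "\<And>y. y \<in> W' \<Longrightarrow> P y = Q y" for W' P Q
      by (rule R_cong[OF W'(1,2)]) (simp_all add: P eq sub[OF _ W'(3)] X Y Z)
    show "R X' (\<lambda>y. P y + Q y) Z x = R X' P Z x + R X' Q Z x"
      if W': "open_in W'" "x \<in> W'" "W' \<subseteq> W" and P: "vfield W' P" "vfield W' Q" for W' P Q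
      by (rule R_add_2[OF W'(1,2)]) (simp_all add: P sub[OF _ W'(3)] X Y Z)
    show "R X' (\<lambda>y. f y *\<^sub>R P y) Z x = f x *\<^sub>R R X' P Z x"
      if W': "open_in W'" "x \<in> W'" "W' \<subseteq> W" and P: "vfield W' P" "smooth_fun M W' f" for W' P f
      by (rule R_scale_2[OF W'(1,2)]) (simp_all add: P sub[OF _ W'(3)] X Y Z)
  qed (use Y in simp_all)
  also have "\<dots> = R X' Y' Z' x"
  proof (rule tensorial[OF W, of "\<lambda>Z. R X' Y' Z x"])
    show "R X' Y' P x = R X' Y' Q x"
      if W': "open_in W'" "x \<in> W'" "W' \<subseteq> W" and P: "vfield W' P" "vfield W' Q"
        and eq: "\<And>y. y \<in> W' \<Longrightarrow> P y = Q y" for W' P Q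
      by (rule R_cong[OF W'(1,2)]) (simp_all add: P eq sub[OF _ W'(3)] X Y Z)
    show "R X' Y' (\<lambda>y. P y + Q y) x = R X' Y' P x + R X' Y' Q x"
      if W': "open_in W'" "x \<in> W'" "W' \<subseteq> W" and P: "vfield W' P" "vfield W' Q" for W' P Q
      by (rule R_add_3[OF W'(1,2)]) (simp_all add: P sub[OF _ W'(3)] X Y Z)
    show "R X' Y' (\<lambda>y. f y *\<^sub>R P y) x = f x *\<^sub>R R X' Y' P x"
      if W': "open_in W'" "x \<in> W'" "W' \<subseteq> W" and P: "vfield W' P" "smooth_fun M W' f" for W' P f
      by (rule R_scale_3[OF W'(1,2)]) (simp_all add: P sub[OF _ W'(3)] X Y Z)
  qed (use Z in simp_all)
  finally show ?thesis .
qed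

text \<open>The curvature on tangent vectors may be computed with any extending fields, not only with those
  that its definition selects.\<close>

lemma curvature_eq:
  assumes W: "open_in W" "x \<in> W" and X: "vfield W X" and Y: "vfield W Y" and Z: "vfield W Z"
  shows "curvature M D x (X x) (Y x) (Z x) = R X Y Z x"
proof -
  have x: "x \<in> points M" using open_in_points[OF W] .
  let ?E = "extend_vector M x"
  note tans = vfield_tan[OF X W(2)] vfield_tan[OF Y W(2)] vfield_tan[OF Z W(2)]
  obtain W1 W2 W3 where W123: "open_in W1" "x \<in> W1" "vfield W1 (?E (X x))"
    "open_in W2" "x \<in> W2" "vfield W2 (?E (Y x))" "open_in W3" "x \<in> W3" "vfield W3 (?E (Z x))"
    using extend_vector(2)[OF x] tans by metis
  let ?W = "W \<inter> W1 \<inter> W2 \<inter> W3"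
  have W': "open_in ?W" "x \<in> ?W" using W W123 by auto
  have vf: "vfield ?W X" "vfield ?W Y" "vfield ?W Z"
    by (rule vfield_subset[OF X] vfield_subset[OF Y] vfield_subset[OF Z], blast)+
  have ext: "vfield ?W (?E (X x))" "vfield ?W (?E (Y x))" "vfield ?W (?E (Z x))"
    by (rule vfield_subset[OF W123(3)] vfield_subset[OF W123(6)] vfield_subset[OF W123(9)], blast)+
  show ?thesis
    unfolding curvature_def
    by (rule R_pointwise[OF W' ext(1) vf(1) _ ext(2) vf(2) _ ext(3) vf(3)])
      (simp_all add: extend_vector(1)[OF x] tans)
qed

subsection \<open>Algebraic symmetries\<close>

lemma g_bilinear: "bilinear_field M g"
  using metric by (simp add: semi_riemannian_metric_def)

lemma g_smooth: "open_in W \<Longrightarrow> vfield W X \<Longrightarrow> vfield W Y \<Longrightarrow> smooth_fun M W (\<lambda>x. g x (X x) (Y x))"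
  using g_bilinear unfolding bilinear_field_def by simp

lemma g_linear: "x \<in> points M \<Longrightarrow> u \<in> tan x \<Longrightarrow> linear_within (tan x) (g x u)"
  using g_bilinear unfolding bilinear_field_def by simp

lemma g_sym: "x \<in> points M \<Longrightarrow> u \<in> tan x \<Longrightarrow> v \<in> tan x \<Longrightarrow> g x u v = g x v u"
  using metric unfolding semi_riemannian_metric_def by simp

lemma g_nondegenerate: "x \<in> points M \<Longrightarrow> u \<in> tan x \<Longrightarrow> (\<And>v. v \<in> tan x \<Longrightarrow> g x u v = 0) \<Longrightarrow> u = 0"
  using metric unfolding semi_riemannian_metric_def by simp

lemma tangent_inner_space:
  assumes "x \<in> points M"
  shows "\<exists>J :: real ^ 'n \<Rightarrow> _. inner_space J (tan x) (g x)"
proof -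
  obtain U \<phi> where c: "(U, \<phi>) \<in> atlas M" "x \<in> U" using chart_exists assms by blast
  have "inner_space (coord_vector M x U \<phi>) (tan x) (g x)"
    by (intro inner_space.intro coord_vector_linear[OF c] coord_vector_inj[OF c]
        tangent_space_chart[OF c] g_linear[OF assms] g_sym[OF assms] g_nondegenerate[OF assms])
  then show ?thesis by blast
qed

text \<open>Compatibility with the metric is applied twice to compute the second derivatives of \<open>g(Z, T)\<close>. In
  their antisymmetrization the mixed terms cancel, and what remains beside the derivative along the
  bracket is the curvature.\<close>

lemma R_skew:
  assumes W: "open_in W" "x \<in> W"
    and X: "vfield W X" and Y: "vfield W Y" and Z: "vfield W Z" and T: "vfield W T"
  shows "g x (R X Y Z x) (T x) + g x (Z x) (R X Y T x) = 0"
proof -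
  note vf = D_vfield[OF W(1)] lie_vfield[OF W(1)] X Y Z T
  have x: "x \<in> points M" using open_in_points[OF W] .
  have tans: "P x \<in> tan x" if "vfield W P" for P using vfield_tan[OF that W(2)] .
  let ?f = "\<lambda>y. g y (Z y) (T y)"
  have second: "act (P x) (\<lambda>y. act (Q y) ?f)
      = g x (D P (D Q Z) x) (T x) + g x (D Q Z x) (D P T x)
        + (g x (D P Z x) (D Q T x) + g x (Z x) (D P (D Q T) x))"
    if P: "vfield W P" and Q: "vfield W Q" for P Q
  proof -
    have "act (P x) (\<lambda>y. act (Q y) ?f) = act (P x) (\<lambda>y. g y (D Q Z y) (T y) + g y (Z y) (D Q T y))"
      by (rule act_cong[OF tans[OF P] W]) (simp add: metric_compatible[OF W(1) _ Q Z T])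
    also have "\<dots> = act (P x) (\<lambda>y. g y (D Q Z y) (T y)) + act (P x) (\<lambda>y. g y (Z y) (D Q T y))"
      by (rule act_add[OF tans[OF P] W]) (simp_all add: g_smooth[OF W(1)] vf P Q)
    finally show ?thesis
      by (simp add: metric_compatible[OF W] vf P Q)
  qed
  have "act (lie X Y x) ?f = act (X x) (\<lambda>y. act (Y y) ?f) - act (Y x) (\<lambda>y. act (X y) ?f)"
    by (rule act_lie_bracket[OF smooth_nearI[OF W g_smooth[OF W(1) Z T]]])
  then have main: "g x (D (lie X Y) Z x) (T x) + g x (Z x) (D (lie X Y) T x)
      = g x (D X (D Y Z) x) (T x) + g x (Z x) (D X (D Y T) x)
        - g x (D Y (D X Z) x) (T x) - g x (Z x) (D Y (D X T) x)"
    using metric_compatible[OF W lie_vfield[OF W(1) X Y] Z T] second[OF X Y] second[OF Y X] by simp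
  obtain J :: "real ^ 'n \<Rightarrow> _" where "inner_space J (tan x) (g x)"
    using tangent_inner_space[OF x] by blast
  then interpret V: inner_space J "tan x" "g x" .
  show ?thesis
    using main by (simp add: R_eq V.h_diff V.h_diff_left tans vf subspace_diff[OF V.V_subspace])
qed

text \<open>For a torsion-free connection the cyclic sum of the curvature is the cyclic sum of iterated
  brackets, so this is the Jacobi identity.\<close>

lemma R_bianchi:
  assumes W: "open_in W" "x \<in> W" and X: "vfield W X" and Y: "vfield W Y" and Z: "vfield W Z"
  shows "R X Y Z x + R Y Z X x + R Z X Y x = 0"
proof -
  note vf = D_vfield[OF W(1)] lie_vfield[OF W(1)] X Y Z
  have tans: "P x \<in> tan x" if "vfield W P" for P using vfield_tan[OF that W(2)] .
  have step: "D P (D Q S) x - D P (D S Q) x - D (lie Q S) P x = lie P (lie Q S) x"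
    if P: "vfield W P" and Q: "vfield W Q" and S: "vfield W S" for P Q S
  proof -
    have "D P (lie Q S) x = D P (\<lambda>y. D Q S y - D S Q y) x"
      by (rule D_cong[OF W]) (simp_all add: vf P Q S vfield_diff[OF W(1)] torsion_free[OF W(1)])
    then show ?thesis
      using torsion_free[OF W P lie_vfield[OF W(1) Q S]] by (simp add: D_diff_right[OF W] vf P Q S)
  qed
  have "R X Y Z x + R Y Z X x + R Z X Y x
      = lie X (lie Y Z) x + lie Y (lie Z X) x + lie Z (lie X Y) x"
    using step[OF X Y Z] step[OF Y Z X] step[OF Z X Y] by (simp add: R_eq algebra_simps)
  also have "\<dots> = 0"
  proof (rule tangent_eqI)
    fix f
    show "act (lie X (lie Y Z) x + lie Y (lie Z X) x + lie Z (lie X Y) x) f = act 0 f"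
    proof (cases "smooth_near M x f")
      case False
      then show ?thesis by (simp add: lie_bracket_def)
    next
      case True
      then obtain W0 where W0: "open_in W0" "x \<in> W0" "smooth_fun M W0 f"
        by (auto simp: smooth_near_def)
      define W' where "W' = W \<inter> W0"
      have W': "open_in W'" "x \<in> W'" "W' \<subseteq> W" using W W0 by (auto simp: W'_def)
      have f: "smooth_fun M W' f" using W0(3) by (rule smooth_fun_subset) (simp add: W'_def)
      have expand: "act (lie P (lie Q S) x) f
        = act (P x) (\<lambda>y. act (Q y) (\<lambda>z. act (S z) f)) - act (P x) (\<lambda>y. act (S y) (\<lambda>z. act (Q z) f))
          - (act (Q x) (\<lambda>y. act (S y) (\<lambda>z. act (P z) f)) - act (S x) (\<lambda>y. act (Q y) (\<lambda>z. act (P z) f)))"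
        if P: "vfield W P" and Q: "vfield W Q" and S: "vfield W S" for P Q S
      proof -
        note sm = vfield_act_smooth[OF W'(1) vfield_subset[OF _ W'(3)]]
        have "act (P x) (\<lambda>y. act (lie Q S y) f)
            = act (P x) (\<lambda>y. act (Q y) (\<lambda>z. act (S z) f) - act (S y) (\<lambda>z. act (Q z) f))"
          by (rule act_cong[OF tans[OF P] W'(1,2)])
            (use act_lie_bracket smooth_nearI[OF W'(1) _ f] in auto)
        also have "\<dots> = act (P x) (\<lambda>y. act (Q y) (\<lambda>z. act (S z) f))
            - act (P x) (\<lambda>y. act (S y) (\<lambda>z. act (Q z) f))"
          using P Q S f by (intro act_diff[OF tans[OF P] W'(1,2)] sm)
        finally show ?thesis
          using act_lie_bracket[OF True, of P "lie Q S"]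
            act_lie_bracket[OF smooth_nearI[OF W'(1,2) sm[OF P f]], of Q S] by simp
      qed
      show ?thesis using expand[OF X Y Z] expand[OF Y Z X] expand[OF Z X Y] by simp
    qed
  qed
  finally show ?thesis .
qed

end

section \<open>Algebraic curvature tensors\<close>

locale algebraic_curvature = inner_space J V h
  for J :: "real ^ 'n \<Rightarrow> 'v::real_vector" and V :: "'v set" and h :: "'v \<Rightarrow> 'v \<Rightarrow> real" +
  fixes R :: "'v \<Rightarrow> 'v \<Rightarrow> 'v \<Rightarrow> 'v"
  assumes R_in: "\<lbrakk>u \<in> V; v \<in> V; w \<in> V\<rbrakk> \<Longrightarrow> R u v w \<in> V"
    and R_linear: "\<lbrakk>u \<in> V; v \<in> V\<rbrakk> \<Longrightarrow> linear_within V (R u v)"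
    and R_antisym: "\<lbrakk>u \<in> V; v \<in> V; w \<in> V\<rbrakk> \<Longrightarrow> R u v w = - R v u w"
    and R_skew: "\<lbrakk>u \<in> V; v \<in> V; w \<in> V; t \<in> V\<rbrakk> \<Longrightarrow> h (R u v w) t = - h w (R u v t)"
    and R_bianchi: "\<lbrakk>u \<in> V; v \<in> V; w \<in> V\<rbrakk> \<Longrightarrow> R u v w + R v w u + R w u v = 0"
begin

text \<open>A signed sum of four instances of the Bianchi identity, in which skewness in both pairs of arguments
  cancels all but two terms.\<close>

lemma R_pair_symmetry:
  assumes u: "u \<in> V" and v: "v \<in> V" and w: "w \<in> V" and t: "t \<in> V"
  shows "h (R u v w) t = h (R w t u) v"
proof -
  have B: "h (R a b c) d + h (R b c a) d + h (R c a b) d = 0"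
    if "a \<in> V" "b \<in> V" "c \<in> V" "d \<in> V" for a b c d
  proof -
    have "h (R a b c + R b c a + R c a b) d = h (R a b c) d + h (R b c a) d + h (R c a b) d"
      using that by (simp add: h_add_left R_in subspace_add[OF V_subspace])
    then show ?thesis
      using R_bianchi that h_zero h_sym[of 0 d] subspace_0[OF V_subspace] by simp
  qed
  have A12: "h (R a b c) d = - h (R b a c) d" if "a \<in> V" "b \<in> V" "c \<in> V" "d \<in> V" for a b c d
    using R_antisym[of a b c] that by (simp add: h_minus_left R_in)
  have A34: "h (R a b c) d = - h (R a b d) c" if "a \<in> V" "b \<in> V" "c \<in> V" "d \<in> V" for a b c d
    using R_skew[of a b c d] h_sym[of c "R a b d"] that by (simp add: R_in)
  show ?thesis
    using B[OF w u v t] B[OF u v t w] B[OF v t w u] B[OF t w u v]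
      A34[OF u v t w] A34[OF v t u w] A34[OF t w v u] A34[OF w u t v] A12[OF v w t u]
      A34[OF v w t u] A12[OF u t w v] A34[OF t u w v] A12[OF t w u v]
    by linarith
qed

definition S :: "'v \<Rightarrow> 'v \<Rightarrow> real" where
  "S v w = trace_on V (\<lambda>u. R u v w)"

text \<open>By the Bianchi identity the antisymmetric part of the Ricci form is the trace of
  a skew-adjoint operator.\<close>

lemma S_sym:
  assumes "v \<in> V" "w \<in> V"
  shows "S v w = S w v"
proof -
  have "R u v w = R u w v - R v w u" if "u \<in> V" for u
    using R_bianchi[of u v w] R_antisym[of w u v] that assms by (simp add: algebra_simps)
  then have "S v w = trace_on V (\<lambda>u. R u w v - R v w u)"
    unfolding S_def by (rule trace_cong)
  also have "\<dots> = S w v - trace_on V (R v w)"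
    unfolding S_def using assms by (intro trace_diff R_in)
  also have "trace_on V (R v w) = 0"
    using assms R_skew R_in R_linear by (intro trace_skew) auto
  finally show ?thesis by simp
qed

lemma S_linear:
  assumes v: "v \<in> V"
  shows "linear_within V (S v)"
proof -
  have "S v (w + w') = S v w + S v w'" if w: "w \<in> V" "w' \<in> V" for w w'
  proof -
    have "S v (w + w') = trace_on V (\<lambda>u. R u v w + R u v w')"
      unfolding S_def using R_linear[OF _ v] w by (intro trace_cong) (simp add: linear_within_def)
    also have "\<dots> = S v w + S v w'"
      unfolding S_def using v w by (intro trace_add R_in)
    finally show ?thesis .
  qed
  moreover have "S v (c *\<^sub>R w) = c *\<^sub>R S v w" if w: "w \<in> V" for c w
  proof -
    have "S v (c *\<^sub>R w) = trace_on V (\<lambda>u. c *\<^sub>R R u v w)"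
      unfolding S_def using R_linear[OF _ v] w by (intro trace_cong) (simp add: linear_within_def)
    also have "\<dots> = c * S v w"
      unfolding S_def using v w by (intro trace_scale R_in)
    finally show ?thesis by simp
  qed
  ultimately show ?thesis by (simp add: linear_within_def)
qed

lemma S_linear_left:
  assumes w: "w \<in> V"
  shows "linear_within V (\<lambda>v. S v w)"
  using S_linear[OF w] S_sym[OF _ w] subspace_add[OF V_subspace] subspace_scale[OF V_subspace]
  by (simp add: linear_within_def)

text \<open>The terms with \<open>a 0\<close>, \<open>a 1\<close> and \<open>a 4\<close> contribute the Ricci form, the dimension and the scalar curvature;
  all others are built from operators of rank one, whose trace is found by evaluation, and from
  the identity.\<close>

lemma trace_T:
  fixes a :: "nat \<Rightarrow> real"
  defines "Q \<equiv> sharp V h S" and "r \<equiv> metric_trace V h S"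
  assumes v: "v \<in> V" and w: "w \<in> V"
  shows "trace_on V (\<lambda>u. a 0 *\<^sub>R R u v w + (a 1 * S v w) *\<^sub>R u + (a 2 * S u w) *\<^sub>R v
        + (a 3 * S u v) *\<^sub>R w + (a 4 * h v w) *\<^sub>R Q u + (a 5 * h u w) *\<^sub>R Q v
        + (a 6 * h u v) *\<^sub>R Q w + (a 7 * r) *\<^sub>R (h v w *\<^sub>R u - h u w *\<^sub>R v))
    = (a 0 + real CARD('n) * a 1 + a 2 + a 3 + a 5 + a 6) * S v w
      + (a 4 + (real CARD('n) - 1) * a 7) * r * h v w"
proof -
  note closed = subspace_add[OF V_subspace] subspace_scale[OF V_subspace] subspace_diff[OF V_subspace]
  have Q: "Q u \<in> V" "h (Q u) y = S u y" if "u \<in> V" "y \<in> V" for u y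
    using sharp_in[of S, OF S_linear] h_sharp[of S, OF S_linear] that by (auto simp: Q_def)
  have rank_one: "trace_on V (\<lambda>u. (c * \<omega> u) *\<^sub>R y) = c * \<omega> y"
    if "linear_within V \<omega>" "y \<in> V" for c \<omega> y
  proof -
    have "linear_within V (\<lambda>u. c * \<omega> u)"
      using that by (auto simp: linear_within_def algebra_simps)
    from trace_rank_one[OF this that(2)] show ?thesis .
  qed
  have h_lin: "linear_within V (\<lambda>u. h u y)" if "y \<in> V" for y
    using that by (auto simp: linear_within_def h_add_left h_scale_left)
  have t0: "trace_on V (\<lambda>u. a 0 *\<^sub>R R u v w) = a 0 * S v w"
    using v w R_in by (simp add: trace_scale S_def)
  have t4: "trace_on V (\<lambda>u. (a 4 * h v w) *\<^sub>R Q u) = a 4 * h v w * r"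
    using Q by (simp add: trace_scale r_def metric_trace_def flip: Q_def)
  have t7: "trace_on V (\<lambda>u. (a 7 * r) *\<^sub>R (h v w *\<^sub>R u - h u w *\<^sub>R v))
      = a 7 * r * (h v w * real CARD('n) - h v w)"
  proof -
    have "trace_on V (\<lambda>u. h v w *\<^sub>R u - h u w *\<^sub>R v)
        = trace_on V (\<lambda>u. h v w *\<^sub>R u) - trace_on V (\<lambda>u. h u w *\<^sub>R v)"
      using v w by (intro trace_diff closed)
    also have "\<dots> = h v w * real CARD('n) - h v w"
      using trace_scaled_id trace_rank_one[OF h_lin[OF w] v] by simp
    finally show ?thesis using v w by (simp add: trace_scale closed)
  qed
  show ?thesis
    using v w
    by (simp add: trace_add closed R_in Q t0 t4 t7 trace_scaled_id rank_one[OF h_lin] rank_one[OF S_linear_left] Q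
        S_sym[of w v]) (simp add: algebra_simps)
qed

text \<open>Pair symmetry moves \<open>\<xi>\<close> from the argument of the curvature operators to their index.\<close>

lemma nullity_curvature:
  assumes \<xi>: "\<xi> \<in> V"
    and null: "\<And>u v. u \<in> V \<Longrightarrow> v \<in> V \<Longrightarrow> R u v \<xi> = k *\<^sub>R (h v \<xi> *\<^sub>R u - h u \<xi> *\<^sub>R v)"
    and v: "v \<in> V" and w: "w \<in> V"
  shows "R \<xi> v w = k *\<^sub>R wedge h \<xi> v w"
proof (rule h_eqI)
  note closed = subspace_scale[OF V_subspace] subspace_diff[OF V_subspace]
  show "R \<xi> v w \<in> V" "k *\<^sub>R wedge h \<xi> v w \<in> V"
    using \<xi> v w by (auto simp: R_in wedge_def closed)
  show "h (R \<xi> v w) t = h (k *\<^sub>R wedge h \<xi> v w) t" if t: "t \<in> V" for t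
    using R_pair_symmetry[OF \<xi> v w t] null[OF w t] \<xi> v w t h_sym[of v w] h_sym[of w \<xi>] h_sym[of \<xi> t]
      h_sym[of v t]
    by (simp add: wedge_def closed h_scale_left h_diff_left algebra_simps)
qed

text \<open>For \<open>L \<noteq> k\<close> the operators \<open>wedge h \<xi> y\<close> annihilate \<open>K\<close>. They determine \<open>K\<close> by its value on \<open>\<xi>\<close>:
  evaluation at \<open>(\<xi>, \<xi>)\<close> gives \<open>K \<xi> y\<close>, and then evaluation at \<open>(\<xi>, w)\<close> gives \<open>K v w\<close>.\<close>

lemma pseudosymmetric_form:
  assumes \<xi>: "\<xi> \<in> V" and unit: "h \<xi> \<xi> * h \<xi> \<xi> = 1"
    and null: "\<And>u v. u \<in> V \<Longrightarrow> v \<in> V \<Longrightarrow> R u v \<xi> = k *\<^sub>R (h v \<xi> *\<^sub>R u - h u \<xi> *\<^sub>R v)"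
    and K_linear: "\<And>u. u \<in> V \<Longrightarrow> linear_within V (K u)"
    and K_sym: "\<And>u v. u \<in> V \<Longrightarrow> v \<in> V \<Longrightarrow> K u v = K v u"
    and pseudo: "\<And>X Y u v. \<lbrakk>X \<in> V; Y \<in> V; u \<in> V; v \<in> V\<rbrakk> \<Longrightarrow>
      derivation_act (R X Y) K u v = L * derivation_act (wedge h X Y) K u v"
    and "L \<noteq> k" and v: "v \<in> V" and w: "w \<in> V"
  shows "K v w = h \<xi> \<xi> * K \<xi> \<xi> * h v w"
proof -
  note closed = subspace_scale[OF V_subspace] subspace_diff[OF V_subspace] subspace_add[OF V_subspace]
  have K_add: "K u (x + y) = K u x + K u y" and K_scale: "K u (c *\<^sub>R x) = c * K u x"
    if "u \<in> V" "x \<in> V" "y \<in> V" for u x y c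
    using K_linear[OF that(1)] that by (auto simp: linear_within_def)
  have K_diff: "K u (x - y) = K u x - K u y" if "u \<in> V" "x \<in> V" "y \<in> V" for u x y
    using K_add[of u x "(-1) *\<^sub>R y"] K_scale[of u y y "-1"] that by (simp add: subspace_neg[OF V_subspace])
  have K_diff_left: "K (x - y) u = K x u - K y u" and K_scale_left: "K (c *\<^sub>R x) u = c * K x u"
    if "u \<in> V" "x \<in> V" "y \<in> V" for u x y c
    using K_diff[of u x y] K_scale[of u x x c] K_sym[of u] that by (auto simp: closed)
  have wedge_in: "wedge h \<xi> y u \<in> V" if "y \<in> V" "u \<in> V" for y u
    using that \<xi> by (simp add: wedge_def closed)
  have annihilated: "K (wedge h \<xi> y u) t + K u (wedge h \<xi> y t) = 0"
    if "y \<in> V" "u \<in> V" "t \<in> V" for y u t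
  proof -
    have "derivation_act (R \<xi> y) K u t = k * derivation_act (wedge h \<xi> y) K u t"
      using that nullity_curvature[OF \<xi> null] wedge_in \<xi>
      by (simp add: derivation_act_def K_scale K_scale_left algebra_simps)
    then have "(L - k) * derivation_act (wedge h \<xi> y) K u t = 0"
      using pseudo[OF \<xi> that] by (simp add: algebra_simps)
    then show ?thesis using \<open>L \<noteq> k\<close> by (simp add: derivation_act_def)
  qed
  have expand: "h y u * K \<xi> t - h \<xi> u * K y t + (h y t * K u \<xi> - h \<xi> t * K u y) = 0"
    if "y \<in> V" "u \<in> V" "t \<in> V" for y u t
    using annihilated[OF that] that \<xi>
    by (simp add: wedge_def closed K_diff K_scale K_diff_left K_scale_left)
  have K_\<xi>: "h \<xi> \<xi> * K \<xi> y = K \<xi> \<xi> * h \<xi> y" if "y \<in> V" for y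
    using expand[OF that \<xi> \<xi>] h_sym[OF that \<xi>] K_sym[OF that \<xi>] by (simp add: algebra_simps)
  have "h \<xi> \<xi> * K v w = h \<xi> v * K \<xi> w - h \<xi> w * K \<xi> v + h v w * K \<xi> \<xi>"
    using expand[OF v \<xi> w] h_sym[OF v \<xi>] by (simp add: algebra_simps)
  moreover have "h \<xi> v * K \<xi> w = h \<xi> w * K \<xi> v"
  proof -
    have "h \<xi> \<xi> * (h \<xi> v * K \<xi> w) = h \<xi> \<xi> * (h \<xi> w * K \<xi> v)"
      using K_\<xi>[OF v] K_\<xi>[OF w] by (metis mult.assoc mult.commute)
    then show ?thesis using unit by auto
  qed
  ultimately have "h \<xi> \<xi> * (h \<xi> \<xi> * K v w) = h \<xi> \<xi> * (h v w * K \<xi> \<xi>)" by simp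
  moreover have "K v w = h \<xi> \<xi> * (h \<xi> \<xi> * K v w)"
    using unit by (simp flip: mult.assoc)
  ultimately show ?thesis by (simp only: ac_simps)
qed

end

section \<open>Pseudosymmetry of manifolds with nullity\<close>

context semi_riemannian
begin

lemma curvature_algebraic:
  assumes x: "x \<in> points M"
  shows "\<exists>J :: real ^ 'n \<Rightarrow> _. algebraic_curvature J (tan x) (g x) (curvature M D x)"
proof -
  obtain J :: "real ^ 'n \<Rightarrow> _" where "inner_space J (tan x) (g x)"
    using tangent_inner_space[OF x] by blast
  then interpret V: inner_space J "tan x" "g x" .
  obtain W where W: "open_in W" "x \<in> W" and ext: "\<And>u. u \<in> tan x \<Longrightarrow> \<exists>X. vfield W X \<and> X x = u"
    using vfield_extension[OF x] by blast
  obtain F where F: "\<And>u. u \<in> tan x \<Longrightarrow> vfield W (F u)" and F_at: "\<And>u. u \<in> tan x \<Longrightarrow> F u x = u"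
    using ext by metis
  have eq: "curvature M D x u v w = R X Y Z x"
    if "vfield W X" "vfield W Y" "vfield W Z" "X x = u" "Y x = v" "Z x = w" for u v w X Y Z
    using curvature_eq[OF W that(1-3)] that(4-6) by simp
  have const: "smooth_fun M W (\<lambda>y. c)" for c by (rule smooth_fun_const)
  note vf = F vfield_add[OF W(1)] vfield_scale[OF W(1) const]
  have "algebraic_curvature J (tan x) (g x) (curvature M D x)"
  proof unfold_locales
    fix u v w assume u: "u \<in> tan x" and v: "v \<in> tan x" and w: "w \<in> tan x"
    note eq_F = eq[OF F F F F_at F_at F_at]
    show "curvature M D x u v w \<in> tan x"
      using eq_F[OF u v w u v w] vfield_tan[OF R_vfield[OF W(1) F[OF u] F[OF v] F[OF w]] W(2)] by simp
    show "curvature M D x u v w = - curvature M D x v u w"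
      using eq_F[OF u v w u v w] eq_F[OF v u w v u w] R_antisym[OF W F[OF u] F[OF v] F[OF w]] by simp
    show "curvature M D x u v w + curvature M D x v w u + curvature M D x w u v = 0"
      using eq_F[OF u v w u v w] eq_F[OF v w u v w u] eq_F[OF w u v w u v]
        R_bianchi[OF W F[OF u] F[OF v] F[OF w]] by simp
    fix t assume t: "t \<in> tan x"
    show "g x (curvature M D x u v w) t = - g x w (curvature M D x u v t)"
      using eq_F[OF u v w u v w] eq_F[OF u v t u v t] R_skew[OF W F[OF u] F[OF v] F[OF w] F[OF t]]
        F_at w t by simp
  next
    fix u v assume u: "u \<in> tan x" and v: "v \<in> tan x"
    have "curvature M D x u v (w + w') = curvature M D x u v w + curvature M D x u v w'"
      if w: "w \<in> tan x" "w' \<in> tan x" for w w'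
      using u v w eq[of "F u" "F v" "\<lambda>y. F w y + F w' y" u v "w + w'"]
        eq[of "F u" "F v" "F w" u v w] eq[of "F u" "F v" "F w'" u v w']
      by (simp add: vf F_at R_add_3[OF W])
    moreover have "curvature M D x u v (c *\<^sub>R w) = c *\<^sub>R curvature M D x u v w"
      if w: "w \<in> tan x" for c w
      using u v w eq[of "F u" "F v" "\<lambda>y. c *\<^sub>R F w y" u v "c *\<^sub>R w"] eq[of "F u" "F v" "F w" u v w]
      by (simp add: vf F_at R_scale_3[OF W const])
    ultimately show "linear_within (tan x) (curvature M D x u v)"
      by (simp add: linear_within_def)
  qed
  then show ?thesis by blast
qed

text \<open>The form \<open>S\<^sub>T\<close> is proportional to the metric wherever \<open>L \<noteq> k\<close>, which is what membership in \<open>\<U>\<close> excludes.\<close>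

lemma pseudosymmetric_function:
  assumes N: "N_manifold M g D k \<xi> \<epsilon>"
    and pseudo: "ricci_pseudosymmetric M g D a L"
    and x: "x \<in> pseudo_set M g D a"
  shows "L x = k"
proof (rule ccontr)
  assume neq: "L x \<noteq> k"
  have pt: "x \<in> points M" using x by (simp add: pseudo_set_def)
  obtain J :: "real ^ 'n \<Rightarrow> _" where "algebraic_curvature J (tan x) (g x) (curvature M D x)"
    using curvature_algebraic[OF pt] by blast
  then interpret V: algebraic_curvature J "tan x" "g x" "curvature M D x" .
  let ?K = "T_ricci M g D a x"
  have S: "ricci M D x = V.S"
    by (intro ext) (simp add: ricci_def V.S_def)
  define \<alpha> where "\<alpha> = a 0 + real CARD('n) * a 1 + a 2 + a 3 + a 5 + a 6"
  define \<beta> where "\<beta> = (a 4 + (real CARD('n) - 1) * a 7) * metric_trace (tan x) (g x) V.S"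
  have K: "?K v w = \<alpha> * V.S v w + \<beta> * g x v w" if "v \<in> tan x" "w \<in> tan x" for v w
    using V.trace_T[OF that, of a]
    unfolding T_ricci_def T_curvature_def ricci_op_def scalar_curvature_def S \<alpha>_def \<beta>_def .
  have \<xi>: "\<xi> x \<in> tan x" "g x (\<xi> x) (\<xi> x) * g x (\<xi> x) (\<xi> x) = 1"
    and null: "\<And>u v. u \<in> tan x \<Longrightarrow> v \<in> tan x \<Longrightarrow>
      curvature M D x u v (\<xi> x) = k *\<^sub>R (g x v (\<xi> x) *\<^sub>R u - g x u (\<xi> x) *\<^sub>R v)"
    using N pt unfolding N_manifold_def by (auto intro: vfield_tan)
  define c where "c = g x (\<xi> x) (\<xi> x) * ?K (\<xi> x) (\<xi> x)"
  have Kc: "?K v w = c * g x v w" if "v \<in> tan x" "w \<in> tan x" for v w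
    unfolding c_def
  proof (rule V.pseudosymmetric_form[OF \<xi> null _ _ _ neq that])
    show "linear_within (tan x) (?K u)" if "u \<in> tan x" for u
      using V.S_linear[OF that] V.h_linear[OF that] that V.V_subspace
      by (auto simp: linear_within_def K subspace_add subspace_scale algebra_simps)
    show "?K u v = ?K v u" if "u \<in> tan x" "v \<in> tan x" for u v
      using that by (simp add: K V.S_sym[of u v] V.h_sym[of u v])
    show "derivation_act (curvature M D x X Y) ?K u v = L x * derivation_act (wedge (g x) X Y) ?K u v"
      if "X \<in> tan x" "Y \<in> tan x" "u \<in> tan x" "v \<in> tan x" for X Y u v
      using pseudo x that unfolding ricci_pseudosymmetric_def by blast
  qed
  have "metric_trace (tan x) (g x) ?K = trace_on (tan x) (\<lambda>u. c *\<^sub>R u)"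
    unfolding metric_trace_def by (rule V.trace_cong) (rule V.sharp_scaled, auto simp: Kc)
  then have "metric_trace (tan x) (g x) ?K = c * real CARD('n)"
    by (simp add: V.trace_scaled_id)
  then show False using x Kc by (auto simp: pseudo_set_def)
qed

end

section \<open>Contact and paracontact structures\<close>

locale contact_structure = semi_riemannian M g D
  for M :: "('p, 'n::finite) mfd" and g :: "'p \<Rightarrow> 'p tangent \<Rightarrow> 'p tangent \<Rightarrow> real"
    and D :: "'p connection" +
  fixes s :: real and \<phi> :: "'p \<Rightarrow> 'p tangent \<Rightarrow> 'p tangent" and \<xi> :: "'p \<Rightarrow> 'p tangent"
    and \<eta> :: "'p \<Rightarrow> 'p tangent \<Rightarrow> real" and \<epsilon> :: real
  assumes tensors: "structure_tensors s M g \<phi> \<xi> \<eta> \<epsilon>" and s_square: "s * s = 1"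
begin

lemma eps_square: "\<epsilon> * \<epsilon> = 1"
  using tensors unfolding structure_tensors_def by auto

lemma phi_vfield: "open_in W \<Longrightarrow> vfield W X \<Longrightarrow> vfield W (\<lambda>x. \<phi> x (X x))"
  using tensors unfolding structure_tensors_def endo_field_def by blast

lemma eta_smooth: "open_in W \<Longrightarrow> vfield W X \<Longrightarrow> smooth_fun M W (\<lambda>x. \<eta> x (X x))"
  using tensors unfolding structure_tensors_def one_form_def by blast

lemma xi_vfield: "open_in W \<Longrightarrow> vfield W \<xi>"
  using tensors openin_subset unfolding structure_tensors_def by (blast intro: vfield_subset)

lemma xi_tan: "x \<in> points M \<Longrightarrow> \<xi> x \<in> tan x"
  using vfield_tan[OF xi_vfield[OF openin_topspace]] .

lemma phi_in: "x \<in> points M \<Longrightarrow> u \<in> tan x \<Longrightarrow> \<phi> x u \<in> tan x"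
  and phi_linear: "x \<in> points M \<Longrightarrow> linear_within (tan x) (\<phi> x)"
  using tensors unfolding structure_tensors_def endo_field_def by blast+

lemma phi_scale: "x \<in> points M \<Longrightarrow> u \<in> tan x \<Longrightarrow> \<phi> x (c *\<^sub>R u) = c *\<^sub>R \<phi> x u"
  using phi_linear unfolding linear_within_def by blast

lemma phi_diff:
  assumes x: "x \<in> points M" and uv: "u \<in> tan x" "v \<in> tan x"
  shows "\<phi> x (u - v) = \<phi> x u - \<phi> x v"
proof -
  have "\<phi> x (u + (-1) *\<^sub>R v) = \<phi> x u + (-1) *\<^sub>R \<phi> x v"
    using phi_linear[OF x] uv subspace_scale[OF tangent_space_subspace[OF x] uv(2), of "-1"]
    unfolding linear_within_def by metis
  then show ?thesis by simp
qed

lemma eta_linear: "x \<in> points M \<Longrightarrow> linear_within (tan x) (\<eta> x)"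
  using tensors unfolding structure_tensors_def one_form_def by blast

lemma eta_xi: "x \<in> points M \<Longrightarrow> \<eta> x (\<xi> x) = 1"
  and phi_phi: "x \<in> points M \<Longrightarrow> u \<in> tan x \<Longrightarrow> \<phi> x (\<phi> x u) = s *\<^sub>R (u - \<eta> x u *\<^sub>R \<xi> x)"
  and g_phi_phi: "x \<in> points M \<Longrightarrow> u \<in> tan x \<Longrightarrow> v \<in> tan x \<Longrightarrow>
    g x (\<phi> x u) (\<phi> x v) = g x u v - \<epsilon> * \<eta> x u * \<eta> x v"
  using tensors unfolding structure_tensors_def by blast+

text \<open>The vector \<open>\<phi> \<xi>\<close> is killed by \<open>\<phi>\<close>, hence a multiple of \<open>\<xi>\<close>; applying \<open>\<phi>\<close> once more shows that the
  multiple is zero.\<close>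

lemma phi_xi:
  assumes x: "x \<in> points M"
  shows "\<phi> x (\<xi> x) = 0"
proof -
  let ?w = "\<phi> x (\<xi> x)"
  have w: "?w \<in> tan x" using phi_in[OF x xi_tan[OF x]] .
  have phi_w: "\<phi> x ?w = 0" using phi_phi[OF x xi_tan[OF x]] eta_xi[OF x] by simp
  have "\<phi> x 0 = 0" using phi_scale[OF x xi_tan[OF x], of 0] by simp
  then have "s *\<^sub>R (?w - \<eta> x ?w *\<^sub>R \<xi> x) = 0" using phi_phi[OF x w] phi_w by simp
  then have w_eq: "?w = \<eta> x ?w *\<^sub>R \<xi> x" using s_square by auto
  then have "\<eta> x ?w *\<^sub>R ?w = 0" using phi_w phi_scale[OF x xi_tan[OF x]] by metis
  then show ?thesis using w_eq by auto
qed

lemma eta_eq: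
  assumes x: "x \<in> points M" and u: "u \<in> tan x"
  shows "\<eta> x u = \<epsilon> * g x u (\<xi> x)"
proof -
  have "g x (\<phi> x u) 0 = 0"
    using g_linear[OF x phi_in[OF x u]] xi_tan[OF x] scaleR_zero_left
    unfolding linear_within_def by (metis real_scaleR_def mult_zero_left)
  then have "g x u (\<xi> x) = \<epsilon> * \<eta> x u"
    using g_phi_phi[OF x u xi_tan[OF x]] phi_xi[OF x] eta_xi[OF x] by simp
  then show ?thesis using eps_square by (simp add: mult.assoc[symmetric])
qed

lemma g_xi: "x \<in> points M \<Longrightarrow> u \<in> tan x \<Longrightarrow> g x u (\<xi> x) = \<epsilon> * \<eta> x u"
  using eta_eq eps_square by (simp add: mult.assoc[symmetric])

lemma g_xi_xi: "x \<in> points M \<Longrightarrow> g x (\<xi> x) (\<xi> x) = \<epsilon>"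
  using g_xi[OF _ xi_tan] eta_xi by simp

lemma phi_cube_eta:
  assumes x: "x \<in> points M" and u: "u \<in> tan x"
  shows "\<eta> x (\<phi> x u) = 0" and "\<phi> x (\<phi> x (\<phi> x u)) = s *\<^sub>R \<phi> x u"
proof -
  have "\<phi> x (\<phi> x (\<phi> x u)) = s *\<^sub>R (\<phi> x u - \<eta> x u *\<^sub>R \<phi> x (\<xi> x))"
    using x u xi_tan[OF x] subspace_scale[OF tangent_space_subspace[OF x]]
      subspace_diff[OF tangent_space_subspace[OF x]]
    by (simp add: phi_phi phi_scale phi_diff)
  then show cube: "\<phi> x (\<phi> x (\<phi> x u)) = s *\<^sub>R \<phi> x u" using phi_xi[OF x] by simp
  have "s *\<^sub>R (\<phi> x u - \<eta> x (\<phi> x u) *\<^sub>R \<xi> x) = s *\<^sub>R \<phi> x u"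
    using cube phi_phi[OF x phi_in[OF x u]] by simp
  moreover have "s \<noteq> 0" using s_square by auto
  ultimately have "\<eta> x (\<phi> x u) *\<^sub>R \<xi> x = 0" by simp
  then show "\<eta> x (\<phi> x u) = 0" using eta_xi[OF x] eta_linear[OF x] xi_tan[OF x]
    unfolding linear_within_def by (metis mult.right_neutral mult_zero_left real_scaleR_def scaleR_zero_left)
qed

text \<open>Since \<open>\<phi> \<xi>\<close> vanishes, the derivative of \<open>\<phi>\<close> applied to \<open>\<xi>\<close> is minus \<open>\<phi>\<close> of the derivative of \<open>\<xi>\<close>;
  and \<open>\<phi>\<close> can be inverted there, because the derivative of a vector field of constant length is
  orthogonal to it.\<close>

lemma nabla_xi:
  assumes W: "open_in W" "x \<in> W" and X: "vfield W X"
  shows "D X \<xi> x = - s *\<^sub>R \<phi> x (endo_deriv D \<phi> X \<xi> x)"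
proof -
  have x: "x \<in> points M" using open_in_points[OF W] .
  note \<xi>W = xi_vfield[OF W(1)]
  let ?d = "D X \<xi> x"
  have d: "?d \<in> tan x" using vfield_tan[OF D_vfield[OF W(1) X \<xi>W] W(2)] .
  have "act (X x) (\<lambda>y. g y (\<xi> y) (\<xi> y)) = act (X x) (\<lambda>y. \<epsilon>)"
    using g_xi_xi open_in_points[OF W(1)] by (intro act_cong[OF vfield_tan[OF X W(2)] W]) auto
  then have "g x ?d (\<xi> x) = 0"
    using metric_compatible[OF W X \<xi>W \<xi>W] act_const[OF vfield_tan[OF X W(2)]]
      g_sym[OF x xi_tan[OF x] d] by simp
  then have "\<eta> x ?d = 0" using eta_eq[OF x d] by simp
  then have phi2: "\<phi> x (\<phi> x ?d) = s *\<^sub>R ?d" using phi_phi[OF x d] by simp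
  have "D X (\<lambda>y. \<phi> y (\<xi> y)) x = 0"
    using phi_xi open_in_points[OF W(1)] by (intro D_local(2)[OF W phi_vfield[OF W(1) \<xi>W] X]) auto
  then have "endo_deriv D \<phi> X \<xi> x = (-1) *\<^sub>R \<phi> x ?d"
    by (simp add: endo_deriv_def)
  then have "\<phi> x (endo_deriv D \<phi> X \<xi> x) = - (s *\<^sub>R ?d)"
    using phi_scale[OF x phi_in[OF x d], of "-1"] phi2 by simp
  then show ?thesis using s_square by simp
qed

text \<open>When the derivative of \<open>\<xi>\<close> is a constant multiple of \<open>\<phi>\<close>, the curvature on \<open>\<xi>\<close> is the
  antisymmetrized derivative of \<open>\<phi>\<close>.\<close>

lemma R_xi:
  assumes nabla: "\<And>W X x. open_in W \<Longrightarrow> x \<in> W \<Longrightarrow> vfield W X \<Longrightarrow> D X \<xi> x = c *\<^sub>R \<phi> x (X x)"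
    and W: "open_in W" "x \<in> W" and X: "vfield W X" and Y: "vfield W Y"
  shows "R X Y \<xi> x = c *\<^sub>R (endo_deriv D \<phi> X Y x - endo_deriv D \<phi> Y X x)"
proof -
  have x: "x \<in> points M" using open_in_points[OF W] .
  have second: "D P (D Q \<xi>) x = c *\<^sub>R D P (\<lambda>y. \<phi> y (Q y)) x"
    if P: "vfield W P" and Q: "vfield W Q" for P Q
  proof -
    note \<phi>Q = phi_vfield[OF W(1) Q]
    have "D P (D Q \<xi>) x = D P (\<lambda>y. c *\<^sub>R \<phi> y (Q y)) x"
      using nabla[OF W(1) _ Q]
      by (intro D_cong[OF W P P refl D_vfield[OF W(1) Q xi_vfield[OF W(1)]]
            vfield_scale[OF W(1) smooth_fun_const \<phi>Q]]) auto
    also have "\<dots> = c *\<^sub>R D P (\<lambda>y. \<phi> y (Q y)) x"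
      using D_scale_right[OF W smooth_fun_const P \<phi>Q, of c] act_const[OF vfield_tan[OF P W(2)]] by simp
    finally show ?thesis .
  qed
  have phi_lie: "\<phi> x (lie X Y x) = \<phi> x (D X Y x) - \<phi> x (D Y X x)"
    using torsion_free[OF W X Y] phi_diff[OF x] vfield_tan[OF D_vfield[OF W(1)] W(2)] X Y by simp
  show ?thesis
    by (simp add: R_eq endo_deriv_def second[OF X Y] second[OF Y X]
        nabla[OF W lie_vfield[OF W(1) X Y]] phi_lie algebra_simps)
qed

text \<open>The factor \<open>\<epsilon>\<close> accounts for \<open>g(X, \<xi>) = \<epsilon> \<eta>(X)\<close>.\<close>

lemma N_manifoldI:
  assumes "\<And>W X Y x. open_in W \<Longrightarrow> x \<in> W \<Longrightarrow> vfield W X \<Longrightarrow> vfield W Y \<Longrightarrow>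
    R X Y \<xi> x = (k * \<epsilon>) *\<^sub>R (\<eta> x (Y x) *\<^sub>R X x - \<eta> x (X x) *\<^sub>R Y x)"
  shows "N_manifold M g D k \<xi> \<epsilon>"
proof -
  have "curvature M D x u v (\<xi> x) = k *\<^sub>R (g x v (\<xi> x) *\<^sub>R u - g x u (\<xi> x) *\<^sub>R v)"
    if x: "x \<in> points M" and uv: "u \<in> tan x" "v \<in> tan x" for x u v
  proof -
    obtain W X Y where W: "open_in W" "x \<in> W" and X: "vfield W X" "X x = u" "vfield W Y" "Y x = v"
      using vfield_extension[OF x] uv by metis
    have "curvature M D x u v (\<xi> x) = (k * \<epsilon>) *\<^sub>R (\<eta> x v *\<^sub>R u - \<eta> x u *\<^sub>R v)"
      using curvature_eq[OF W X(1,3) xi_vfield[OF W(1)]] assms[OF W X(1,3)] X by simp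
    then show ?thesis using g_xi[OF x] uv by (simp add: scaleR_diff_right mult.assoc)
  qed
  then show ?thesis
    using tensors g_xi_xi levi_civita unfolding N_manifold_def structure_tensors_def by blast
qed

end

lemma (in semi_riemannian) eps_sasakian_nullity:
  assumes "eps_sasakian M g D \<phi> \<xi> \<eta> \<epsilon>"
  shows "N_manifold M g D \<epsilon> \<xi> \<epsilon>"
proof -
  interpret contact_structure M g D "-1" \<phi> \<xi> \<eta> \<epsilon>
    using assms by unfold_locales (auto simp: eps_sasakian_def)
  have deriv: "endo_deriv D \<phi> X Y x = g x (X x) (Y x) *\<^sub>R \<xi> x - (\<epsilon> * \<eta> x (Y x)) *\<^sub>R X x"
    if "open_in W" "x \<in> W" "vfield W X" "vfield W Y" for W X Y x
    using assms that unfolding eps_sasakian_def by blast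
  have nabla: "D X \<xi> x = (- \<epsilon>) *\<^sub>R \<phi> x (X x)" if W: "open_in W" "x \<in> W" and X: "vfield W X" for W X x
  proof -
    have x: "x \<in> points M" using open_in_points[OF W] .
    have Xx: "X x \<in> tan x" using vfield_tan[OF X W(2)] .
    have "endo_deriv D \<phi> X \<xi> x = g x (X x) (\<xi> x) *\<^sub>R \<xi> x - \<epsilon> *\<^sub>R X x"
      using deriv[OF W X xi_vfield[OF W(1)]] eta_xi[OF x] by simp
    then show ?thesis
      using nabla_xi[OF W X] phi_diff[OF x] phi_scale[OF x] phi_xi[OF x] xi_tan[OF x] Xx
        subspace_scale[OF tangent_space_subspace[OF x]] by simp
  qed
  show ?thesis
  proof (rule N_manifoldI)
    fix W X Y x assume W: "open_in W" "x \<in> W" and X: "vfield W X" and Y: "vfield W Y"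
    have x: "x \<in> points M" using open_in_points[OF W] .
    have "R X Y \<xi> x = (- \<epsilon>) *\<^sub>R ((\<epsilon> * \<eta> x (X x)) *\<^sub>R Y x - (\<epsilon> * \<eta> x (Y x)) *\<^sub>R X x)"
      using R_xi[OF nabla W X Y] deriv[OF W X Y] deriv[OF W Y X]
        g_sym[OF x vfield_tan[OF X W(2)] vfield_tan[OF Y W(2)]] by simp
    then show "R X Y \<xi> x = (\<epsilon> * \<epsilon>) *\<^sub>R (\<eta> x (Y x) *\<^sub>R X x - \<eta> x (X x) *\<^sub>R Y x)"
      by (simp add: algebra_simps)
  qed
qed

lemma (in semi_riemannian) eps_para_sasakian_nullity:
  assumes "eps_para_sasakian M g D \<phi> \<xi> \<eta> \<epsilon>"
  shows "N_manifold M g D (- \<epsilon>) \<xi> \<epsilon>"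
proof -
  interpret contact_structure M g D 1 \<phi> \<xi> \<eta> \<epsilon>
    using assms by unfold_locales (auto simp: eps_para_sasakian_def)
  have deriv: "endo_deriv D \<phi> X Y x = - (g x (\<phi> x (X x)) (\<phi> x (Y x)) *\<^sub>R \<xi> x)
      - (\<epsilon> * \<eta> x (Y x)) *\<^sub>R \<phi> x (\<phi> x (X x))"
    if "open_in W" "x \<in> W" "vfield W X" "vfield W Y" for W X Y x
    using assms that unfolding eps_para_sasakian_def by blast
  have nabla: "D X \<xi> x = \<epsilon> *\<^sub>R \<phi> x (X x)" if W: "open_in W" "x \<in> W" and X: "vfield W X" for W X x
  proof -
    have x: "x \<in> points M" using open_in_points[OF W] .
    have Xx: "X x \<in> tan x" using vfield_tan[OF X W(2)] .
    have "g x (\<phi> x (X x)) (\<phi> x (\<xi> x)) = 0"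
      using g_phi_phi[OF x Xx xi_tan[OF x]] g_xi[OF x Xx] eta_xi[OF x] by simp
    then have "endo_deriv D \<phi> X \<xi> x = (- \<epsilon>) *\<^sub>R \<phi> x (\<phi> x (X x))"
      using deriv[OF W X xi_vfield[OF W(1)]] eta_xi[OF x] by simp
    then have "D X \<xi> x = - (\<phi> x ((- \<epsilon>) *\<^sub>R \<phi> x (\<phi> x (X x))))"
      using nabla_xi[OF W X] by simp
    also have "\<dots> = \<epsilon> *\<^sub>R \<phi> x (X x)"
      using phi_scale[OF x phi_in[OF x phi_in[OF x Xx]], of "- \<epsilon>"] phi_cube_eta(2)[OF x Xx] by simp
    finally show ?thesis .
  qed
  show ?thesis
  proof (rule N_manifoldI)
    fix W X Y x assume W: "open_in W" "x \<in> W" and X: "vfield W X" and Y: "vfield W Y"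
    have x: "x \<in> points M" using open_in_points[OF W] .
    have t: "X x \<in> tan x" "Y x \<in> tan x" using vfield_tan X Y W(2) by blast+
    have "R X Y \<xi> x = \<epsilon> *\<^sub>R ((\<epsilon> * \<eta> x (X x)) *\<^sub>R \<phi> x (\<phi> x (Y x)) - (\<epsilon> * \<eta> x (Y x)) *\<^sub>R \<phi> x (\<phi> x (X x)))"
      using R_xi[OF nabla W X Y] deriv[OF W X Y] deriv[OF W Y X]
        g_sym[OF x phi_in[OF x t(1)] phi_in[OF x t(2)]] by simp
    then show "R X Y \<xi> x = (- \<epsilon> * \<epsilon>) *\<^sub>R (\<eta> x (Y x) *\<^sub>R X x - \<eta> x (X x) *\<^sub>R Y x)"
      using phi_phi[OF x] t by (simp add: algebra_simps)
  qed
qed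

text \<open>Here the derivative of \<open>\<xi>\<close> involves \<open>\<eta>\<close>, so that the curvature on \<open>\<xi>\<close> contains the exterior derivative
  of \<open>\<eta>\<close> as a coefficient of \<open>\<xi>\<close>. It vanishes, because \<open>g(Y, \<nabla>\<^sub>X \<xi>)\<close> is symmetric in \<open>X\<close> and \<open>Y\<close>.\<close>

lemma (in semi_riemannian) kenmotsu_nullity:
  assumes "kenmotsu M g D \<phi> \<xi> \<eta>"
  shows "N_manifold M g D (- 1) \<xi> 1"
proof -
  interpret contact_structure M g D "-1" \<phi> \<xi> \<eta> 1
    using assms by unfold_locales (auto simp: kenmotsu_def almost_contact_metric_def)
  have deriv: "endo_deriv D \<phi> X Y x = g x (\<phi> x (X x)) (Y x) *\<^sub>R \<xi> x - \<eta> x (Y x) *\<^sub>R \<phi> x (X x)"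
    if "open_in W" "x \<in> W" "vfield W X" "vfield W Y" for W X Y x
    using assms that unfolding kenmotsu_def by blast
  have nabla: "D X \<xi> x = X x - \<eta> x (X x) *\<^sub>R \<xi> x"
    if W: "open_in W" "x \<in> W" and X: "vfield W X" for W X x
  proof -
    have x: "x \<in> points M" using open_in_points[OF W] .
    have Xx: "X x \<in> tan x" using vfield_tan[OF X W(2)] .
    have "endo_deriv D \<phi> X \<xi> x = (-1) *\<^sub>R \<phi> x (X x)"
      using deriv[OF W X xi_vfield[OF W(1)]] eta_xi[OF x] g_xi[OF x phi_in[OF x Xx]]
        phi_cube_eta(1)[OF x Xx] by simp
    then have "D X \<xi> x = \<phi> x ((-1) *\<^sub>R \<phi> x (X x))"
      using nabla_xi[OF W X] by simp
    also have "\<dots> = - \<phi> x (\<phi> x (X x))"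
      using phi_scale[OF x phi_in[OF x Xx], of "-1"] by simp
    finally show ?thesis using phi_phi[OF x Xx] by simp
  qed
  show ?thesis
  proof (rule N_manifoldI)
    fix W X Y x assume W: "open_in W" "x \<in> W" and X: "vfield W X" and Y: "vfield W Y"
    have x: "x \<in> points M" using open_in_points[OF W] .
    note \<xi>W = xi_vfield[OF W(1)]
    have tans: "P x \<in> tan x" if "vfield W P" for P using vfield_tan[OF that W(2)] .
    have second: "D P (D Q \<xi>) x
        = D P Q x - \<eta> x (Q x) *\<^sub>R (P x - \<eta> x (P x) *\<^sub>R \<xi> x) - act (P x) (\<lambda>y. \<eta> y (Q y)) *\<^sub>R \<xi> x"
      if P: "vfield W P" and Q: "vfield W Q" for P Q
    proof -
      note sQ = eta_smooth[OF W(1) Q]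
      note vQ = vfield_scale[OF W(1) sQ \<xi>W]
      have "D P (D Q \<xi>) x = D P (\<lambda>y. Q y - \<eta> y (Q y) *\<^sub>R \<xi> y) x"
        using nabla[OF W(1) _ Q]
        by (intro D_cong[OF W P P refl D_vfield[OF W(1) Q \<xi>W] vfield_diff[OF W(1) Q vQ]]) auto
      also have "\<dots> = D P Q x - D P (\<lambda>y. \<eta> y (Q y) *\<^sub>R \<xi> y) x"
        by (rule D_diff_right[OF W Q vQ P])
      finally show ?thesis
        using D_scale_right[OF W sQ P \<xi>W] nabla[OF W P] by simp
    qed
    have eta_g: "\<eta> y u = g y u (\<xi> y)" if "y \<in> points M" "u \<in> tan y" for y u
      using eta_eq[OF that] by simp
    have act_eta: "act (P x) (\<lambda>y. \<eta> y (Q y)) = \<eta> x (D P Q x) + (g x (Q x) (P x) - \<eta> x (P x) * \<eta> x (Q x))"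
      if P: "vfield W P" and Q: "vfield W Q" for P Q
    proof -
      have "act (P x) (\<lambda>y. \<eta> y (Q y)) = act (P x) (\<lambda>y. g y (Q y) (\<xi> y))"
        using eta_g open_in_points[OF W(1)] vfield_tan[OF Q]
        by (intro act_cong[OF tans[OF P] W]) auto
      also have "\<dots> = g x (D P Q x) (\<xi> x) + g x (Q x) (P x - \<eta> x (P x) *\<^sub>R \<xi> x)"
        using metric_compatible[OF W P Q \<xi>W] nabla[OF W P] by simp
      also have "g x (Q x) (P x - \<eta> x (P x) *\<^sub>R \<xi> x) = g x (Q x) (P x) - \<eta> x (P x) * g x (Q x) (\<xi> x)"
      proof -
        obtain J :: "real ^ 'n \<Rightarrow> _" where "inner_space J (tan x) (g x)"
          using tangent_inner_space[OF x] by blast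
        then interpret V: inner_space J "tan x" "g x" .
        show ?thesis
          using tans[OF P] tans[OF Q] xi_tan[OF x]
          by (simp add: V.h_diff V.h_scale subspace_scale[OF V.V_subspace])
      qed
      finally show ?thesis
        using eta_g[OF x] tans[OF D_vfield[OF W(1) P Q]] tans[OF Q] by simp
    qed
    have eta_lie: "\<eta> x (D X Y x - D Y X x) = \<eta> x (D X Y x) - \<eta> x (D Y X x)"
    proof -
      have t: "D X Y x \<in> tan x" "D Y X x \<in> tan x" using tans D_vfield[OF W(1)] X Y by blast+
      have "\<eta> x (D X Y x + (-1) *\<^sub>R D Y X x) = \<eta> x (D X Y x) + (-1) * \<eta> x (D Y X x)"
        using eta_linear[OF x] t subspace_scale[OF tangent_space_subspace[OF x] t(2), of "-1"]
        unfolding linear_within_def by (metis real_scaleR_def)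
      then show ?thesis by simp
    qed
    show "R X Y \<xi> x = (- 1 * 1) *\<^sub>R (\<eta> x (Y x) *\<^sub>R X x - \<eta> x (X x) *\<^sub>R Y x)"
      by (simp add: R_eq second[OF X Y] second[OF Y X] act_eta[OF X Y] act_eta[OF Y X]
          nabla[OF W lie_vfield[OF W(1) X Y]] torsion_free[OF W X Y] eta_lie
          g_sym[OF x tans[OF Y] tans[OF X]] algebra_simps)
  qed
qed

section \<open>The pseudosymmetry theorem\<close>

theorem theorem6p25:
  fixes M :: "('p, 'n::finite) mfd"
    and g :: "'p \<Rightarrow> 'p tangent \<Rightarrow> 'p tangent \<Rightarrow> real"
    and D :: "'p connection"
    and a :: "nat \<Rightarrow> real"
    and L :: "'p \<Rightarrow> real"
  assumes "smooth_manifold M"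
    and "semi_riemannian_metric M g"
    and "levi_civita M g D"
    and "a 0 + real CARD('n) * a 1 + a 2 + a 3 + a 5 + a 6 \<noteq> 0"
    and "ricci_pseudosymmetric M g D a L"
  shows
    "(\<forall>k \<xi> \<epsilon>. N_manifold M g D k \<xi> \<epsilon> \<longrightarrow>
        einstein_with M g D (k * (real CARD('n) - 1)) \<or> (\<forall>x\<in>pseudo_set M g D a. L x = k)) \<and>
     (\<forall>k \<phi> \<xi> \<eta>. N_contact_metric M g D k \<phi> \<xi> \<eta> \<longrightarrow>
        einstein_with M g D (k * (real CARD('n) - 1)) \<or> (\<forall>x\<in>pseudo_set M g D a. L x = k)) \<and>
     (\<forall>\<phi> \<xi> \<eta>. sasakian M g D \<phi> \<xi> \<eta> \<longrightarrow>
        einstein_with M g D (real CARD('n) - 1) \<or> (\<forall>x\<in>pseudo_set M g D a. L x = 1)) \<and>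
     (\<forall>\<phi> \<xi> \<eta>. kenmotsu M g D \<phi> \<xi> \<eta> \<longrightarrow>
        einstein_with M g D (- (real CARD('n) - 1)) \<or> (\<forall>x\<in>pseudo_set M g D a. L x = -1)) \<and>
     (\<forall>\<phi> \<xi> \<eta> \<epsilon>. eps_sasakian M g D \<phi> \<xi> \<eta> \<epsilon> \<longrightarrow>
        einstein_with M g D (\<epsilon> * (real CARD('n) - 1)) \<or> (\<forall>x\<in>pseudo_set M g D a. L x = \<epsilon>)) \<and>
     (\<forall>\<phi> \<xi> \<eta>. para_sasakian M g D \<phi> \<xi> \<eta> \<longrightarrow>
        einstein_with M g D (- (real CARD('n) - 1)) \<or> (\<forall>x\<in>pseudo_set M g D a. L x = -1)) \<and>
     (\<forall>\<phi> \<xi> \<eta> \<epsilon>. eps_para_sasakian M g D \<phi> \<xi> \<eta> \<epsilon> \<longrightarrow>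
        einstein_with M g D (- \<epsilon> * (real CARD('n) - 1)) \<or> (\<forall>x\<in>pseudo_set M g D a. L x = - \<epsilon>))"
proof -
  interpret semi_riemannian M g D
    using assms(1-3) by unfold_locales
  have nullity: "\<forall>x\<in>pseudo_set M g D a. L x = k" if "N_manifold M g D k \<xi> \<epsilon>" for k \<xi> \<epsilon>
    using pseudosymmetric_function[OF that assms(5)] by blast
  have contact: "\<forall>x\<in>pseudo_set M g D a. L x = k" if "N_contact_metric M g D k \<phi> \<xi> \<eta>" for k \<phi> \<xi> \<eta>
    using nullity that unfolding N_contact_metric_def by blast
  have sasakian: "\<forall>x\<in>pseudo_set M g D a. L x = 1" if "sasakian M g D \<phi> \<xi> \<eta>" for \<phi> \<xi> \<eta>
    using nullity eps_sasakian_nullity that unfolding sasakian_def by blast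
  have kenmotsu: "\<forall>x\<in>pseudo_set M g D a. L x = -1" if "kenmotsu M g D \<phi> \<xi> \<eta>" for \<phi> \<xi> \<eta>
    by (rule nullity[OF kenmotsu_nullity[OF that]])
  have eps_sasakian: "\<forall>x\<in>pseudo_set M g D a. L x = \<epsilon>" if "eps_sasakian M g D \<phi> \<xi> \<eta> \<epsilon>" for \<phi> \<xi> \<eta> \<epsilon>
    by (rule nullity[OF eps_sasakian_nullity[OF that]])
  have para_sasakian: "\<forall>x\<in>pseudo_set M g D a. L x = -1" if "para_sasakian M g D \<phi> \<xi> \<eta>" for \<phi> \<xi> \<eta>
    using nullity eps_para_sasakian_nullity that unfolding para_sasakian_def by blast
  have eps_para_sasakian: "\<forall>x\<in>pseudo_set M g D a. L x = - \<epsilon>" if "eps_para_sasakian M g D \<phi> \<xi> \<eta> \<epsilon>" for \<phi> \<xi> \<eta> \<epsilon>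
    by (rule nullity[OF eps_para_sasakian_nullity[OF that]])
  show ?thesis
    by (intro conjI allI impI disjI2;
        erule nullity contact sasakian kenmotsu eps_sasakian para_sasakian eps_para_sasakian)
qed

end
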